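(* Let $B$ be a non-empty finite set and $k$ a commutative coefficient ring. The elements $$r^{(1)}_{ij}(\tau,a)=\sum_{\alpha:\,i\alpha j}m(\tau(\alpha))-\sum_{\alpha:\,j\alpha i}m(\tau(\alpha)),$$ for all partitions $\tau=(\tau_1,\dots,\tau_N)$ of $B$, all $a\le N$ with $|\tau_a|\ge2$, and all $i\ne j$ in $\tau_a$ (with $\alpha$ running over ordered 2-partitions of $\tau_a$), span the intersection of $I_B$ with the $k$-submodule of $\mathcal R_B$ generated by the good monomials.
   Context: **Partitions.** A partition $\tau=(\tau_1,\dots,\tau_N)$ of $B$ is a totally ordered family of non-empty pairwise disjoint subsets with union $B$ (an $N$-partition). $i\tau j$ means that $i,j$ lie in different parts and the part containing $i$ precedes the part containing $j$; the same notation is used for partitions of subsets of $B$. For a 2-partition $\alpha=(\tau_{a1},\tau_{a2})$ of the set $\tau_a$, put $\tau(\alpha)=(\tau_1,\dots,\tau_{a-1},\tau_{a1},\tau_{a2},\tau_{a+1},\dots,\tau_N)$. **The ring.** $\mathcal R_B$ is the polynomial ring over $k$ in commuting independent variables $l_\sigma$ indexed by the 2-partitions $\sigma$ of $B$. $I_B\subset\mathcal R_B$ is the ideal generated by $$r^{(1)}_{ij}=\sum_{\sigma:\,i\sigma j}l_\sigma-\sum_{\rho:\,j\rho i}l_\rho\quad(i,j\in B),$$ $$r^{(2)}(\sigma,\rho)=l_\sigma l_\rho\quad\text{whenever there exist } i,j\in B\text{ with } i\sigma j\text{ and } j\rho i.$$ **Good monomials.** For an $(N+1)$-partition $\tau$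 with $N\ge1$, the good monomial is $m(\tau)=l_{\sigma^{(1)}}\cdots l_{\sigma^{(N)}}\in\mathcal R_B$, where $\sigma^{(a)}=(\tau_1\cup\dots\cup\tau_a,\ \tau_{a+1}\cup\dots\cup\tau_{N+1})$, $a=1,\dots,N$. For the trivial 1-partition, $m(\tau)=1$. *)

theory Defs
  imports Complex_Main "HOL-Library.Poly_Mapping" "HOL-Library.Disjoint_Sets" "HOL-Algebra.Ideal"
begin

section \<open>Ordered partitions\<close>

text \<open>
  A partition \<open>(\<tau>\<^sub>1, \<dots>, \<tau>\<^sub>N)\<close> of a set is the list of its parts in their order. List positions
  start at 0, so the part \<open>\<tau>\<^sub>a\<close> is \<open>\<tau> ! (a - 1)\<close>.
\<close>

definition ordered_partition :: "'b set \<Rightarrow> 'b set list \<Rightarrow> bool" where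
  "ordered_partition B \<tau> \<longleftrightarrow>
     {} \<notin> set \<tau> \<and> disjoint_family_on (\<lambda>a. \<tau> ! a) {..<length \<tau>} \<and> \<Union>(set \<tau>) = B"

definition two_partitions :: "'b set \<Rightarrow> 'b set list set" where
  "two_partitions B = {\<sigma>. ordered_partition B \<sigma> \<and> length \<sigma> = 2}"

text \<open>The relation \<open>i \<tau> j\<close>.\<close>

definition precedes :: "'b set list \<Rightarrow> 'b \<Rightarrow> 'b \<Rightarrow> bool" where
  "precedes \<tau> i j \<longleftrightarrow> (\<exists>a c. a < c \<and> c < length \<tau> \<and> i \<in> \<tau> ! a \<and> j \<in> \<tau> ! c)"

text \<open>The partition \<open>\<tau>(\<alpha>)\<close>, where \<open>\<alpha>\<close> is a 2-partition of the part \<open>\<tau> ! a\<close>.\<close>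

definition split_part :: "'b set list \<Rightarrow> nat \<Rightarrow> 'b set list \<Rightarrow> 'b set list" where
  "split_part \<tau> a \<alpha> = take a \<tau> @ \<alpha> @ drop (Suc a) \<tau>"

lemma finite_two_partitions:
  assumes "finite B"
  shows "finite (two_partitions B)"
proof (rule finite_subset)
  show "two_partitions B \<subseteq> {xs. set xs \<subseteq> Pow B \<and> length xs = 2}"
    by (auto simp: two_partitions_def ordered_partition_def)
  show "finite {xs. set xs \<subseteq> Pow B \<and> length xs = 2}"
    using assms by (intro finite_lists_length_eq) simp
qed

section \<open>The polynomial ring\<close>

text \<open>
  The type below is the polynomial ring over \<open>'k\<close> in variables indexed by all lists of subsets
  of \<open>'b\<close>. \<open>R_carrier B\<close> consists of the polynomials involving only the variables indexed by
  2-partitions of \<open>B\<close>, and \<open>R_ring B\<close> is this subring in the record format of HOL-Algebra.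
\<close>

type_synonym ('b, 'k) pol = "('b set list \<Rightarrow>\<^sub>0 nat) \<Rightarrow>\<^sub>0 'k"

definition R_carrier :: "'b set \<Rightarrow> ('b, 'k::comm_ring_1) pol set" where
  "R_carrier B = {p. \<forall>m \<in> Poly_Mapping.keys p. Poly_Mapping.keys m \<subseteq> two_partitions B}"

definition R_ring :: "'b set \<Rightarrow> ('b, 'k::comm_ring_1) pol ring" where
  "R_ring B = \<lparr>carrier = R_carrier B, monoid.mult = (*), one = 1, zero = 0, add = (+)\<rparr>"

definition pvar :: "'b set list \<Rightarrow> ('b, 'k::comm_ring_1) pol" where
  "pvar \<sigma> = Poly_Mapping.single (Poly_Mapping.single \<sigma> 1) 1"

definition pscale :: "'k \<Rightarrow> ('b, 'k::comm_ring_1) pol \<Rightarrow> ('b, 'k) pol" where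
  "pscale c p = Poly_Mapping.single 0 c * p"

text \<open>The \<open>'k\<close>-submodule generated by a set of polynomials.\<close>

abbreviation kspan :: "('b, 'k::comm_ring_1) pol set \<Rightarrow> ('b, 'k) pol set" where
  "kspan \<equiv> module.span pscale"

lemma module_pscale: "module (pscale :: 'k::comm_ring_1 \<Rightarrow> ('b, 'k) pol \<Rightarrow> ('b, 'k) pol)"
proof
  fix a b :: 'k and x y :: "('b, 'k) pol"
  show "pscale a (x + y) = pscale a x + pscale a y"
    by (simp add: pscale_def algebra_simps)
  show "pscale (a + b) x = pscale a x + pscale b x"
    by (simp add: pscale_def single_add algebra_simps)
  show "pscale a (pscale b x) = pscale (a * b) x"
    by (simp add: pscale_def mult_single flip: mult.assoc)
  show "pscale 1 x = x"
    by (simp add: pscale_def)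
qed

lemma cring_R_ring: "cring (R_ring B :: ('b, 'k::comm_ring_1) pol ring)"
proof -
  have add: "x + y \<in> R_carrier B"
    if "x \<in> R_carrier B" "y \<in> R_carrier B" for x y :: "('b, 'k) pol"
    using that keys_add[of x y] unfolding R_carrier_def by blast
  have mult: "x * y \<in> R_carrier B"
    if x: "x \<in> R_carrier B" and y: "y \<in> R_carrier B" for x y :: "('b, 'k) pol"
    unfolding R_carrier_def
  proof (intro CollectI ballI)
    fix m assume "m \<in> Poly_Mapping.keys (x * y)"
    then obtain u v where "u \<in> Poly_Mapping.keys x" "v \<in> Poly_Mapping.keys y" "m = u + v"
      using keys_mult[of x y] by blast
    then show "Poly_Mapping.keys m \<subseteq> two_partitions B"
      using x y keys_add[of u v] unfolding R_carrier_def by blast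
  qed
  have neg: "- x \<in> R_carrier B" if "x \<in> R_carrier B" for x :: "('b, 'k) pol"
  proof -
    have "Poly_Mapping.keys (- x) = Poly_Mapping.keys x"
      by (auto simp: in_keys_iff)
    with that show ?thesis by (simp add: R_carrier_def)
  qed
  have const: "0 \<in> R_carrier B" "1 \<in> R_carrier B"
    by (auto simp: R_carrier_def)
  show ?thesis
  proof (intro cringI abelian_groupI comm_monoidI)
    fix x :: "('b, 'k) pol" assume "x \<in> carrier (R_ring B)"
    then show "\<exists>y\<in>carrier (R_ring B). y \<oplus>\<^bsub>R_ring B\<^esub> x = \<zero>\<^bsub>R_ring B\<^esub>"
      using neg by (auto simp: R_ring_def intro!: bexI[of _ "- x"])
  qed (auto simp: R_ring_def add mult const algebra_simps)
qed

section \<open>The ideal and the good monomials\<close>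

definition r1 :: "'b set \<Rightarrow> 'b \<Rightarrow> 'b \<Rightarrow> ('b, 'k::comm_ring_1) pol" where
  "r1 B i j = (\<Sum>\<sigma> \<in> {\<sigma> \<in> two_partitions B. precedes \<sigma> i j}. pvar \<sigma>)
            - (\<Sum>\<rho> \<in> {\<rho> \<in> two_partitions B. precedes \<rho> j i}. pvar \<rho>)"

definition I_gens :: "'b set \<Rightarrow> ('b, 'k::comm_ring_1) pol set" where
  "I_gens B = {r1 B i j | i j. i \<in> B \<and> j \<in> B}
     \<union> {pvar \<sigma> * pvar \<rho> | \<sigma> \<rho>. \<sigma> \<in> two_partitions B \<and> \<rho> \<in> two_partitions B
          \<and> (\<exists>i \<in> B. \<exists>j \<in> B. precedes \<sigma> i j \<and> precedes \<rho> j i)}"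

definition I_ideal :: "'b set \<Rightarrow> ('b, 'k::comm_ring_1) pol set" where
  "I_ideal B = genideal (R_ring B) (I_gens B)"

text \<open>For a partition with a single part the product is empty, so the monomial is \<open>1\<close>.\<close>

definition good_monomial :: "'b set list \<Rightarrow> ('b, 'k::comm_ring_1) pol" where
  "good_monomial \<tau> = (\<Prod>a \<in> {1..<length \<tau>}. pvar [\<Union>(set (take a \<tau>)), \<Union>(set (drop a \<tau>))])"

definition r1_at :: "'b set list \<Rightarrow> nat \<Rightarrow> 'b \<Rightarrow> 'b \<Rightarrow> ('b, 'k::comm_ring_1) pol" where
  "r1_at \<tau> a i j =
     (\<Sum>\<alpha> \<in> {\<alpha> \<in> two_partitions (\<tau> ! a). precedes \<alpha> i j}. good_monomial (split_part \<tau> a \<alpha>))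
   - (\<Sum>\<alpha> \<in> {\<alpha> \<in> two_partitions (\<tau> ! a). precedes \<alpha> j i}. good_monomial (split_part \<tau> a \<alpha>))"

end

theory Submission
  imports Defs
begin

text \<open>
  Write \<open>l\<^sub>\<sigma>\<close> for the variable \<open>pvar \<sigma>\<close>. The quadratic relations kill exactly the monomials whose
  support contains two crossing 2-partitions. The other supports, called flags below, correspond
  to the ordered partitions of \<open>B\<close> by taking the 2-partitions into which a partition can be cut,
  and the good monomials are the square-free monomials on flags. For \<open>i\<close> and \<open>j\<close> in one part of
  \<open>\<tau>\<close>, the product of the linear relation \<open>r1 B i j\<close> with the good monomial of \<open>\<tau>\<close> is \<open>r1_at \<tau> a i j\<close>
  up to crossing monomials (\<open>r1_mult_flag_monomial\<close>), because the only 2-partitions that separate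
  \<open>i\<close> from \<open>j\<close> and cross no cut of \<open>\<tau>\<close> are those that split this part. So the elements
  \<open>r1_at \<tau> a i j\<close> lie in the ideal.

  For the converse, regard the polynomials modulo crossing monomials as a module over the ring
  generated by the linear relations. Up to monomials with larger support, \<open>r1 B i j\<close> kills the
  good monomial of \<open>\<tau>\<close> if \<open>i\<close> and \<open>j\<close> lie in one part, and multiplies it by \<open>l\<^sub>\<sigma>\<close> if \<open>i\<close> and \<open>j\<close> lie in
  adjacent parts and \<open>\<sigma>\<close> is the cut between them. Choose for each flag \<open>C\<close> and each \<open>\<sigma> \<in> C\<close> a
  relation \<open>\<theta>\<^sub>\<sigma>\<close> of the second kind, and attach to a monomial \<open>u\<close> with support \<open>C\<close> and exponents
  \<open>u\<^sub>\<sigma>\<close> the adapted polynomial, which is the product of the factors \<open>l\<^sub>\<sigma> \<theta>\<^sub>\<sigma>\<^sup>n\<close> with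
  \<open>n = u\<^sub>\<sigma> - 1\<close>. It equals \<open>u\<close> plus monomials with larger support. By this triangularity the
  adapted polynomials are linearly independent modulo crossing monomials
  (\<open>adapted_independent\<close>), and every polynomial is, modulo crossing monomials, a combination of
  products of linear relations with good monomials (\<open>R_carrier_generated\<close>). Hence the ideal is
  spanned by crossing monomials and by multiples of good monomials by products of at least one
  linear relation (\<open>I_ideal_subset_relation_span\<close>).

  Such a multiple can be reduced: each linear relation is a combination of the chosen \<open>\<theta>\<^sub>\<sigma>\<close> and
  of relations inside the parts of \<open>\<tau>\<close>. If only the \<open>\<theta>\<^sub>\<sigma>\<close> occur, the product is an adapted
  polynomial of a monomial that is not square-free. A relation inside a part turns the good
  monomial into some \<open>r1_at \<tau> a i j\<close>, which is itself a combination of good monomials of finer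
  partitions, so that the remaining factors can be treated by induction
  (\<open>pos_multiple_reduction\<close>). Therefore an element \<open>f\<close> of the ideal is a combination \<open>n\<close> of the
  elements \<open>r1_at \<tau> a i j\<close>, plus a combination of adapted polynomials of monomials that are not
  square-free, plus crossing monomials. If \<open>f\<close> is also a combination of good monomials, then so
  is \<open>f - n\<close>; but good monomials are the adapted polynomials of square-free monomials, and
  independence gives \<open>f = n\<close>. This argument works over every commutative ring of coefficients,
  since the triangular system has diagonal entries \<open>1\<close>.
\<close>

section \<open>Ordered partitions and chains of 2-partitions\<close>

lemma two_partitions_pair:
  "[S, T] \<in> two_partitions B \<longleftrightarrow> S \<noteq> {} \<and> T \<noteq> {} \<and> S \<inter> T = {} \<and> S \<union> T = B"
proof -
  have "{..<length [S, T]} = {0, 1}" by auto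
  then show ?thesis
    unfolding two_partitions_def ordered_partition_def
    by (auto simp: disjoint_family_on_def)
qed

lemma two_partitionsE:
  assumes "\<sigma> \<in> two_partitions B"
  obtains S T where "\<sigma> = [S, T]" "S \<noteq> {}" "T \<noteq> {}" "S \<inter> T = {}" "S \<union> T = B"
proof -
  obtain S T where "\<sigma> = [S, T]"
    using assms by (auto simp: two_partitions_def numeral_2_eq_2 length_Suc_conv)
  then show thesis using that assms two_partitions_pair by metis
qed

lemma two_partitionsD:
  assumes "\<sigma> \<in> two_partitions B"
  shows "\<sigma> ! 0 \<noteq> {}" "\<sigma> ! 1 \<noteq> {}" "\<sigma> ! 1 = B - \<sigma> ! 0" "\<sigma> ! 0 \<subseteq> B"
  using assms by (auto elim!: two_partitionsE)

lemma two_partitions_eqI: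
  assumes "\<sigma> \<in> two_partitions B" "\<rho> \<in> two_partitions B" "\<sigma> ! 0 = \<rho> ! 0"
  shows "\<sigma> = \<rho>"
proof -
  obtain S T where \<sigma>: "\<sigma> = [S, T]" "S \<inter> T = {}" "S \<union> T = B" using assms(1) by (rule two_partitionsE)
  obtain S' T' where \<rho>: "\<rho> = [S', T']" "S' \<inter> T' = {}" "S' \<union> T' = B" using assms(2) by (rule two_partitionsE)
  have "S = S'" using assms(3) \<sigma>(1) \<rho>(1) by simp
  moreover then have "T = T'" using \<sigma> \<rho> by blast
  ultimately show ?thesis using \<sigma>(1) \<rho>(1) by simp
qed

lemma precedes_two_partition:
  assumes "\<sigma> \<in> two_partitions B"
  shows "precedes \<sigma> i j \<longleftrightarrow> i \<in> \<sigma> ! 0 \<and> j \<in> \<sigma> ! 1"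
proof -
  have "length \<sigma> = 2" using assms by (simp add: two_partitions_def)
  then show ?thesis unfolding precedes_def by (auto simp: less_2_cases_iff)
qed

lemma ordered_partitionD:
  assumes "ordered_partition B \<tau>" "a < length \<tau>"
  shows "\<tau> ! a \<noteq> {}" "\<tau> ! a \<subseteq> B"
  using assms unfolding ordered_partition_def by (metis nth_mem, metis Union_upper nth_mem)

lemma part_index_unique:
  assumes "ordered_partition B \<tau>" "a < length \<tau>" "c < length \<tau>" "x \<in> \<tau> ! a" "x \<in> \<tau> ! c"
  shows "a = c"
  using assms unfolding ordered_partition_def disjoint_family_on_def by blast

lemma part_index_exists:
  assumes "ordered_partition B \<tau>" "x \<in> B"
  obtains a where "a < length \<tau>" "x \<in> \<tau> ! a"
  using assms unfolding ordered_partition_def by (metis UnionE in_set_conv_nth)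

lemma ordered_partitionI:
  assumes "\<And>a. a < length \<tau> \<Longrightarrow> \<tau> ! a \<noteq> {}"
    and "\<And>a. a < length \<tau> \<Longrightarrow> \<tau> ! a \<subseteq> B"
    and "\<And>a c x. a < length \<tau> \<Longrightarrow> c < length \<tau> \<Longrightarrow> x \<in> \<tau> ! a \<Longrightarrow> x \<in> \<tau> ! c \<Longrightarrow> a = c"
    and "\<And>x. x \<in> B \<Longrightarrow> \<exists>a < length \<tau>. x \<in> \<tau> ! a"
  shows "ordered_partition B \<tau>"
  unfolding ordered_partition_def disjoint_family_on_def
proof (intro conjI ballI impI)
  show "{} \<notin> set \<tau>" using assms(1) by (auto simp: in_set_conv_nth)
  show "\<tau> ! m \<inter> \<tau> ! n = {}" if mn: "m \<in> {..<length \<tau>}" "n \<in> {..<length \<tau>}" "m \<noteq> n" for m n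
  proof (rule equals0I)
    fix x assume "x \<in> \<tau> ! m \<inter> \<tau> ! n"
    then show False using assms(3)[of m n x] mn by simp
  qed
  have "set \<tau> = (!) \<tau> ` {..<length \<tau>}" by (auto simp: in_set_conv_nth)
  then have "x \<in> \<Union>(set \<tau>) \<longleftrightarrow> (\<exists>a < length \<tau>. x \<in> \<tau> ! a)" for x by auto
  then show "\<Union> (set \<tau>) = B" using assms(2,4) by blast
qed

text \<open>
  Cutting \<open>\<tau>\<close> after its first \<open>p\<close> parts; for \<open>p\<close> equal to \<open>0\<close> or to the number of parts, one of the
  two halves is empty, so \<open>cuts\<close> ranges over the values in between.
\<close>
definition cut_at :: "'b set list \<Rightarrow> nat \<Rightarrow> 'b set list" where
  "cut_at \<tau> p = [\<Union>(set (take p \<tau>)), \<Union>(set (drop p \<tau>))]"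

definition cuts :: "'b set list \<Rightarrow> 'b set list set" where
  "cuts \<tau> = cut_at \<tau> ` {1..<length \<tau>}"

lemma in_cut:
  assumes \<tau>: "ordered_partition B \<tau>" and a: "a < length \<tau>" and x: "x \<in> \<tau> ! a"
  shows "x \<in> cut_at \<tau> p ! 0 \<longleftrightarrow> a < p" "x \<in> cut_at \<tau> p ! 1 \<longleftrightarrow> p \<le> a"
proof -
  have only: "c = a" if "c < length \<tau>" "x \<in> \<tau> ! c" for c
    using part_index_unique[OF \<tau> a _ x] that by metis
  have "x \<in> \<Union>(set (take p \<tau>)) \<longleftrightarrow> (\<exists>c < length (take p \<tau>). x \<in> take p \<tau> ! c)"
    by (simp only: Union_iff Bex_def in_set_conv_nth) metis
  also have "\<dots> \<longleftrightarrow> a < p"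
  proof
    assume "\<exists>c < length (take p \<tau>). x \<in> take p \<tau> ! c"
    then obtain c where c: "c < length \<tau>" "c < p" "x \<in> \<tau> ! c" by auto
    then show "a < p" using only[OF c(1,3)] by simp
  next
    assume "a < p"
    then show "\<exists>c < length (take p \<tau>). x \<in> take p \<tau> ! c" using a x by (intro exI[of _ a]) auto
  qed
  finally show "x \<in> cut_at \<tau> p ! 0 \<longleftrightarrow> a < p" by (simp add: cut_at_def)
  have "x \<in> \<Union>(set (drop p \<tau>)) \<longleftrightarrow> (\<exists>c < length (drop p \<tau>). x \<in> drop p \<tau> ! c)"
    by (simp only: Union_iff Bex_def in_set_conv_nth) metis
  also have "\<dots> \<longleftrightarrow> (\<exists>c < length \<tau> - p. x \<in> \<tau> ! (p + c))" by auto
  also have "\<dots> \<longleftrightarrow> p \<le> a"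
  proof
    assume "\<exists>c < length \<tau> - p. x \<in> \<tau> ! (p + c)"
    then obtain c where c: "c < length \<tau> - p" "x \<in> \<tau> ! (p + c)" by blast
    then have "p + c = a" using only[of "p + c"] by simp
    then show "p \<le> a" by simp
  next
    assume "p \<le> a"
    then show "\<exists>c < length \<tau> - p. x \<in> \<tau> ! (p + c)" using a x by (intro exI[of _ "a - p"]) auto
  qed
  finally show "x \<in> cut_at \<tau> p ! 1 \<longleftrightarrow> p \<le> a" by (simp add: cut_at_def)
qed

lemma cut_in_two_partitions:
  assumes \<tau>: "ordered_partition B \<tau>" and p: "1 \<le> p" "p < length \<tau>"
  shows "cut_at \<tau> p \<in> two_partitions B"
proof -
  have 0: "0 < length \<tau>" using p by linarith
  obtain x where x: "x \<in> \<tau> ! 0" using ordered_partitionD[OF \<tau> 0] by auto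
  obtain y where y: "y \<in> \<tau> ! p" using ordered_partitionD[OF \<tau> p(2)] by auto
  have "x \<in> cut_at \<tau> p ! 0" "y \<in> cut_at \<tau> p ! 1"
    using in_cut[OF \<tau> 0 x] in_cut[OF \<tau> p(2) y] p by auto
  moreover have "cut_at \<tau> p ! 0 \<inter> cut_at \<tau> p ! 1 = {}"
  proof (rule ccontr)
    assume "cut_at \<tau> p ! 0 \<inter> cut_at \<tau> p ! 1 \<noteq> {}"
    then obtain z where z: "z \<in> cut_at \<tau> p ! 0" "z \<in> cut_at \<tau> p ! 1" by auto
    then have "z \<in> B" using \<tau> unfolding cut_at_def ordered_partition_def
      by (auto dest: in_set_takeD)
    then show False using part_index_exists[OF \<tau>] in_cut[OF \<tau>] z by (metis not_less)
  qed
  moreover have "cut_at \<tau> p ! 0 \<union> cut_at \<tau> p ! 1 = B"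
  proof -
    have "set (take p \<tau>) \<union> set (drop p \<tau>) = set \<tau>"
      by (metis append_take_drop_id set_append)
    then show ?thesis using \<tau> unfolding cut_at_def ordered_partition_def by auto
  qed
  ultimately show ?thesis using two_partitions_pair[of "cut_at \<tau> p ! 0" "cut_at \<tau> p ! 1" B]
    by (auto simp: cut_at_def)
qed

lemma cut_inj_on: 
  assumes \<tau>: "ordered_partition B \<tau>"
  shows "inj_on (cut_at \<tau>) {1..<length \<tau>}"
proof (rule inj_onI)
  have *: "\<not> p < q" if pq: "p < length \<tau>" "cut_at \<tau> p = cut_at \<tau> q" for p q
  proof
    assume "p < q"
    obtain x where x: "x \<in> \<tau> ! p" using ordered_partitionD(1)[OF \<tau> pq(1)] by auto
    show False
      using in_cut(1)[OF \<tau> pq(1) x, of p] in_cut(1)[OF \<tau> pq(1) x, of q] \<open>p < q\<close>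
      unfolding pq(2) by simp
  qed
  fix p q assume "p \<in> {1..<length \<tau>}" "q \<in> {1..<length \<tau>}" "cut_at \<tau> p = cut_at \<tau> q"
  then have "\<not> p < q" "\<not> q < p" using *[of p q] *[of q p] by simp_all
  then show "p = q" by simp
qed

text \<open>
  In terms of the first parts, two 2-partitions cross if and only if neither first part contains
  the other, so a flag below is a chain of non-empty proper subsets of \<open>B\<close>.
\<close>
definition crossing :: "'b set list \<Rightarrow> 'b set list \<Rightarrow> bool" where
  "crossing \<sigma> \<rho> \<longleftrightarrow> (\<exists>i j. precedes \<sigma> i j \<and> precedes \<rho> j i)"

definition flag :: "'b set \<Rightarrow> 'b set list set \<Rightarrow> bool" where
  "flag B C \<longleftrightarrow> C \<subseteq> two_partitions B \<and> (\<forall>\<sigma>\<in>C. \<forall>\<rho>\<in>C. \<not> crossing \<sigma> \<rho>)"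

lemma flag_cuts:
  assumes \<tau>: "ordered_partition B \<tau>"
  shows "flag B (cuts \<tau>)"
  unfolding flag_def
proof (intro conjI ballI)
  show sub: "cuts \<tau> \<subseteq> two_partitions B"
    using cut_in_two_partitions[OF \<tau>] unfolding cuts_def by auto
  fix \<sigma> \<rho> assume "\<sigma> \<in> cuts \<tau>" "\<rho> \<in> cuts \<tau>"
  then obtain p q where pq: "\<sigma> = cut_at \<tau> p" "\<rho> = cut_at \<tau> q" "\<sigma> \<in> two_partitions B" "\<rho> \<in> two_partitions B"
    using sub unfolding cuts_def by auto
  show "\<not> crossing \<sigma> \<rho>"
  proof
    assume "crossing \<sigma> \<rho>"
    then obtain i j where ij: "i \<in> \<sigma> ! 0" "j \<in> \<sigma> ! 1" "j \<in> \<rho> ! 0" "i \<in> \<rho> ! 1"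
      using pq unfolding crossing_def by (auto simp: precedes_two_partition)
    then have "i \<in> B" "j \<in> B" using two_partitionsD(4)[OF pq(3)] two_partitionsD(4)[OF pq(4)] by auto
    then obtain a c where i: "a < length \<tau>" "i \<in> \<tau> ! a" and j: "c < length \<tau>" "j \<in> \<tau> ! c"
      using part_index_exists[OF \<tau>] by metis
    have "a < p" "p \<le> c" "c < q" "q \<le> a"
      using in_cut[OF \<tau> i] in_cut[OF \<tau> j] ij unfolding pq(1,2) by simp_all
    then show False by simp
  qed
qed

lemma flag_subset: "flag B C \<Longrightarrow> D \<subseteq> C \<Longrightarrow> flag B D"
  unfolding flag_def by blast

lemma flag_finite: "finite B \<Longrightarrow> flag B C \<Longrightarrow> finite C"
  unfolding flag_def using finite_two_partitions finite_subset by blast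

text \<open>
  A 2-partition that respects all parts of \<open>\<tau>\<close> and crosses no cut must have an initial segment of
  parts as its first half, so it would be a cut itself.
\<close>
lemma cut_compatible_separates_part:
  assumes \<tau>: "ordered_partition B \<tau>" and \<sigma>: "\<sigma> \<in> two_partitions B" "\<sigma> \<notin> cuts \<tau>"
    and compat: "\<And>\<rho>. \<rho> \<in> cuts \<tau> \<Longrightarrow> \<not> crossing \<sigma> \<rho>"
  obtains a i j where "a < length \<tau>" "i \<in> \<tau> ! a" "j \<in> \<tau> ! a" "precedes \<sigma> i j"
proof (rule ccontr)
  assume "\<not> thesis"
  with that have no: "\<not> precedes \<sigma> i j" if "a < length \<tau>" "i \<in> \<tau> ! a" "j \<in> \<tau> ! a" for a i j
    using that by blast
  have mono: "\<not> q < p" if "p < length \<tau>" "q < length \<tau>" "i \<in> \<tau> ! p" "j \<in> \<tau> ! q" "precedes \<sigma> i j" for p q i j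
  proof
    assume "q < p"
    then have "cut_at \<tau> p \<in> cuts \<tau>" using that by (auto simp: cuts_def)
    moreover have "precedes (cut_at \<tau> p) j i"
      using that(1) \<open>q < p\<close> in_cut(2)[OF \<tau> that(1,3), of p] in_cut(1)[OF \<tau> that(2,4), of p]
        precedes_two_partition[OF cut_in_two_partitions[OF \<tau>, of p]] by simp
    ultimately show False using compat that(5) unfolding crossing_def by blast
  qed
  \<comment> \<open>No part meets both halves of \<open>\<sigma>\<close>, so the parts in the first half form an initial segment;
      its length is the index of the first part that meets the second half.\<close>
  define p where "p = (LEAST p. p < length \<tau> \<and> \<tau> ! p \<inter> \<sigma> ! 1 \<noteq> {})"
  obtain y where "y \<in> \<sigma> ! 1" using two_partitionsD[OF \<sigma>(1)] by auto
  moreover then have "y \<in> B" using two_partitionsD[OF \<sigma>(1)] by auto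
  ultimately have "\<exists>p. p < length \<tau> \<and> \<tau> ! p \<inter> \<sigma> ! 1 \<noteq> {}"
    using part_index_exists[OF \<tau>] by (metis disjoint_iff)
  from LeastI_ex[OF this] have p: "p < length \<tau>" "\<tau> ! p \<inter> \<sigma> ! 1 \<noteq> {}"
    unfolding p_def by simp_all
  have least: "\<tau> ! q \<inter> \<sigma> ! 1 = {}" if "q < p" "q < length \<tau>" for q
    using not_less_Least[of q "\<lambda>p. p < length \<tau> \<and> \<tau> ! p \<inter> \<sigma> ! 1 \<noteq> {}"] that
    unfolding p_def by blast
  have mem: "x \<in> \<sigma> ! 0 \<longleftrightarrow> a < p" if a: "a < length \<tau>" "x \<in> \<tau> ! a" for a x
  proof
    assume x: "x \<in> \<sigma> ! 0"
    obtain y where y: "y \<in> \<tau> ! p" "y \<in> \<sigma> ! 1" using p(2) by blast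
    have "precedes \<sigma> x y" using x y precedes_two_partition[OF \<sigma>(1)] by simp
    then have "\<not> p < a" "a \<noteq> p" using mono[OF a(1) p(1) a(2) y(1)] no[OF a] y(1) by blast+
    then show "a < p" by simp
  next
    assume "a < p"
    then have "x \<notin> \<sigma> ! 1" using least[of a] a by blast
    moreover have "x \<in> B" using ordered_partitionD[OF \<tau> a(1)] a by blast
    ultimately show "x \<in> \<sigma> ! 0" using two_partitionsD[OF \<sigma>(1)] by blast
  qed
  obtain x where "x \<in> \<sigma> ! 0" using two_partitionsD[OF \<sigma>(1)] by auto
  moreover then obtain a where "a < length \<tau>" "x \<in> \<tau> ! a"
    using two_partitionsD(4)[OF \<sigma>(1)] part_index_exists[OF \<tau>] by blast
  ultimately have "1 \<le> p" using mem[of a x] by simp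
  then have cut: "cut_at \<tau> p \<in> two_partitions B" using cut_in_two_partitions[OF \<tau>] p by auto
  have "\<sigma> ! 0 = cut_at \<tau> p ! 0"
  proof (rule Set.set_eqI)
    fix x
    show "x \<in> \<sigma> ! 0 \<longleftrightarrow> x \<in> cut_at \<tau> p ! 0"
    proof (cases "x \<in> B")
      case True
      then obtain a where "a < length \<tau>" "x \<in> \<tau> ! a" using part_index_exists[OF \<tau>] by blast
      then show ?thesis using mem in_cut(1)[OF \<tau>] by simp
    next
      case False
      then show ?thesis using two_partitionsD(4)[OF \<sigma>(1)] two_partitionsD(4)[OF cut] by auto
    qed
  qed
  then have "\<sigma> = cut_at \<tau> p" using two_partitions_eqI[OF \<sigma>(1) cut] by simp
  then show False using \<open>\<sigma> \<notin> cuts \<tau>\<close> p \<open>1 \<le> p\<close> by (auto simp: cuts_def)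
qed

section \<open>Splitting one part\<close>

text \<open>
  The one cut of the refined partition that is not a cut of \<open>\<tau>\<close>: all earlier parts and the first
  half of \<open>\<alpha>\<close> against the second half of \<open>\<alpha>\<close> and all later parts.
\<close>
definition lift :: "'b set list \<Rightarrow> nat \<Rightarrow> 'b set list \<Rightarrow> 'b set list" where
  "lift \<tau> a \<alpha> = cut_at (split_part \<tau> a \<alpha>) (Suc a)"

context
  fixes B :: "'b set" and \<tau> :: "'b set list" and a :: nat
  assumes \<tau>: "ordered_partition B \<tau>" and a: "a < length \<tau>"
begin

lemma length_split_part:
  "\<alpha> \<in> two_partitions (\<tau> ! a) \<Longrightarrow> length (split_part \<tau> a \<alpha>) = Suc (length \<tau>)"
  using a by (auto simp: split_part_def two_partitions_def)

lemma nth_split_part: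
  assumes \<alpha>: "\<alpha> \<in> two_partitions (\<tau> ! a)" and "c < Suc (length \<tau>)"
  shows "split_part \<tau> a \<alpha> ! c =
    (if c < a then \<tau> ! c else if c = a then \<alpha> ! 0 else if c = Suc a then \<alpha> ! 1 else \<tau> ! (c - 1))"
proof -
  have "length \<alpha> = 2" using \<alpha> by (simp add: two_partitions_def)
  then show ?thesis using assms a
    by (auto simp: split_part_def nth_append less_2_cases_iff min_def Suc_diff_Suc numeral_2_eq_2)
qed

lemma ordered_partition_split_part:
  assumes \<alpha>: "\<alpha> \<in> two_partitions (\<tau> ! a)"
  shows "ordered_partition B (split_part \<tau> a \<alpha>)"
proof -
  let ?s = "split_part \<tau> a \<alpha>"
  let ?old = "\<lambda>c. if c \<le> a then c else c - 1"
  note len = length_split_part[OF \<alpha>] and nth = nth_split_part[OF \<alpha>]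
  note \<alpha>' = two_partitionsD[OF \<alpha>]
  have old: "?old c < length \<tau>" "?s ! c \<subseteq> \<tau> ! ?old c" if "c < length ?s" for c
    using that a len nth[of c] \<alpha>' by (auto split: if_splits)
  show ?thesis
  proof (rule ordered_partitionI)
    fix c assume c: "c < length ?s"
    show "?s ! c \<noteq> {}" using c nth[of c] len \<alpha>' ordered_partitionD(1)[OF \<tau>] a by auto
    show "?s ! c \<subseteq> B" using old[OF c] ordered_partitionD(2)[OF \<tau>] by blast
    fix d x assume d: "d < length ?s" and x: "x \<in> ?s ! c" "x \<in> ?s ! d"
    have "?old c = ?old d" using part_index_unique[OF \<tau>] old[OF c] old[OF d] x by blast
    moreover have "\<alpha> ! 0 \<inter> \<alpha> ! 1 = {}" using \<alpha>' by auto
    ultimately show "c = d" using x c d len nth[of c] nth[of d] by (auto split: if_splits)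
  next
    fix x assume "x \<in> B"
    then obtain c where c: "c < length \<tau>" "x \<in> \<tau> ! c" using part_index_exists[OF \<tau>] by metis
    consider "c < a" | "c = a" "x \<in> \<alpha> ! 0" | "c = a" "x \<in> \<alpha> ! 1" | "c > a"
      using c \<alpha>' by fastforce
    then show "\<exists>d < length ?s. x \<in> ?s ! d"
    proof cases
      case 1 then show ?thesis using c nth[of c] len by (intro exI[of _ c]) auto
    next
      case 2 then show ?thesis using c nth[of a] len by (intro exI[of _ a]) auto
    next
      case 3 then show ?thesis using c nth[of "Suc a"] len by (intro exI[of _ "Suc a"]) auto
    next
      case 4 then show ?thesis using c nth[of "Suc c"] len by (intro exI[of _ "Suc c"]) auto
    qed
  qed
qed

lemma lift_in_two_partitions:
  "\<alpha> \<in> two_partitions (\<tau> ! a) \<Longrightarrow> lift \<tau> a \<alpha> \<in> two_partitions B"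
  unfolding lift_def
  using cut_in_two_partitions[OF ordered_partition_split_part] length_split_part a by simp

lemma lift_on_part:
  assumes \<alpha>: "\<alpha> \<in> two_partitions (\<tau> ! a)" and x: "x \<in> \<tau> ! a"
  shows "x \<in> lift \<tau> a \<alpha> ! 0 \<longleftrightarrow> x \<in> \<alpha> ! 0"
proof -
  note op = ordered_partition_split_part[OF \<alpha>]
  have "a < length (split_part \<tau> a \<alpha>)" "Suc a < length (split_part \<tau> a \<alpha>)"
    "split_part \<tau> a \<alpha> ! a = \<alpha> ! 0" "split_part \<tau> a \<alpha> ! Suc a = \<alpha> ! 1"
    using length_split_part[OF \<alpha>] nth_split_part[OF \<alpha>] a by auto
  moreover have "x \<in> \<alpha> ! 0 \<or> x \<in> \<alpha> ! 1" "\<alpha> ! 0 \<inter> \<alpha> ! 1 = {}" using two_partitionsD[OF \<alpha>] x by auto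
  ultimately show ?thesis
    unfolding lift_def using in_cut(1)[OF op, of a x "Suc a"] in_cut(1)[OF op, of "Suc a" x "Suc a"] by auto
qed

lemma lift_off_part:
  assumes \<alpha>: "\<alpha> \<in> two_partitions (\<tau> ! a)" and c: "c < length \<tau>" "c \<noteq> a" and x: "x \<in> \<tau> ! c"
  shows "x \<in> lift \<tau> a \<alpha> ! 0 \<longleftrightarrow> c < a"
proof -
  note op = ordered_partition_split_part[OF \<alpha>]
  let ?d = "if c < a then c else Suc c"
  have "?d < length (split_part \<tau> a \<alpha>)" "split_part \<tau> a \<alpha> ! ?d = \<tau> ! c"
    using length_split_part[OF \<alpha>] nth_split_part[OF \<alpha>, of ?d] c by auto
  then show ?thesis
    unfolding lift_def using in_cut(1)[OF op, of ?d x "Suc a"] x c by (auto split: if_splits)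
qed

lemma precedes_lift:
  assumes \<alpha>: "\<alpha> \<in> two_partitions (\<tau> ! a)" and "precedes \<alpha> i j"
  shows "precedes (lift \<tau> a \<alpha>) i j"
proof -
  have "i \<in> \<alpha> ! 0" "j \<in> \<alpha> ! 1" using assms by (auto simp: precedes_two_partition)
  moreover then have "i \<in> \<tau> ! a" "j \<in> \<tau> ! a" "j \<notin> \<alpha> ! 0" using two_partitionsD[OF \<alpha>] by auto
  moreover have "\<tau> ! a \<subseteq> B" using ordered_partitionD[OF \<tau> a] by auto
  ultimately show ?thesis
    using lift_on_part[OF \<alpha>] lift_in_two_partitions[OF \<alpha>] two_partitionsD(3)[OF lift_in_two_partitions[OF \<alpha>]]
    by (auto simp: precedes_two_partition)
qed

lemma inj_on_lift: "inj_on (lift \<tau> a) (two_partitions (\<tau> ! a))"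
proof (rule inj_onI)
  fix \<alpha> \<beta> assume \<alpha>: "\<alpha> \<in> two_partitions (\<tau> ! a)" and \<beta>: "\<beta> \<in> two_partitions (\<tau> ! a)"
    and "lift \<tau> a \<alpha> = lift \<tau> a \<beta>"
  then have "x \<in> \<alpha> ! 0 \<longleftrightarrow> x \<in> \<beta> ! 0" if "x \<in> \<tau> ! a" for x
    using lift_on_part that by metis
  then show "\<alpha> = \<beta>"
    using two_partitionsD(4)[OF \<alpha>] two_partitionsD(4)[OF \<beta>] by (intro two_partitions_eqI[OF \<alpha> \<beta>]) blast
qed

lemma lift_notin_cuts:
  assumes \<alpha>: "\<alpha> \<in> two_partitions (\<tau> ! a)"
  shows "lift \<tau> a \<alpha> \<notin> cuts \<tau>"
proof
  assume "lift \<tau> a \<alpha> \<in> cuts \<tau>"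
  then obtain p where p: "lift \<tau> a \<alpha> = cut_at \<tau> p" by (auto simp: cuts_def)
  obtain x y where xy: "x \<in> \<alpha> ! 0" "y \<in> \<alpha> ! 1" using two_partitionsD[OF \<alpha>] by auto
  then have "x \<in> \<tau> ! a" "y \<in> \<tau> ! a" "y \<notin> \<alpha> ! 0" using two_partitionsD[OF \<alpha>] by auto
  then show False using lift_on_part[OF \<alpha>] in_cut(1)[OF \<tau> a] p xy by auto
qed

lemma cuts_split_part:
  assumes \<alpha>: "\<alpha> \<in> two_partitions (\<tau> ! a)"
  shows "cuts (split_part \<tau> a \<alpha>) = insert (lift \<tau> a \<alpha>) (cuts \<tau>)"
proof -
  obtain S T where ST: "\<alpha> = [S, T]" "S \<union> T = \<tau> ! a" using \<alpha> by (rule two_partitionsE)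
  obtain xs ys where \<tau>_eq: "\<tau> = xs @ (S \<union> T) # ys" and xs: "length xs = a"
    and split: "split_part \<tau> a \<alpha> = xs @ S # T # ys"
  proof (rule that[of "take a \<tau>" "drop (Suc a) \<tau>"])
    show "\<tau> = take a \<tau> @ (S \<union> T) # drop (Suc a) \<tau>" using a ST(2) id_take_nth_drop[OF a] by simp
    show "length (take a \<tau>) = a" using a by simp
    show "split_part \<tau> a \<alpha> = take a \<tau> @ S # T # drop (Suc a) \<tau>" by (simp add: split_part_def ST(1))
  qed
  have low: "cut_at (split_part \<tau> a \<alpha>) p = cut_at \<tau> p" if "p \<le> a" for p
    using that xs by (simp only: cut_at_def split) (simp add: \<tau>_eq Un_assoc)
  have high: "cut_at (split_part \<tau> a \<alpha>) (Suc p) = cut_at \<tau> p" if "p > a" for p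
  proof -
    have "p = Suc (a + (p - Suc a))" using that by simp
    then obtain q where "p = Suc (a + q)" by blast
    then show ?thesis using xs by (simp only: cut_at_def split) (simp add: \<tau>_eq Un_assoc)
  qed
  have "{1..<length (split_part \<tau> a \<alpha>)} = insert (Suc a) ({1..a} \<union> Suc ` {Suc a..<length \<tau>})"
    using a by (auto simp: length_split_part[OF \<alpha>] image_Suc_atLeastLessThan)
  moreover have "{1..<length \<tau>} = {1..a} \<union> {Suc a..<length \<tau>}" using a by auto
  moreover have "(\<lambda>p. cut_at (split_part \<tau> a \<alpha>) p) ` {1..a} = cut_at \<tau> ` {1..a}"
    using low by (intro image_cong) auto
  moreover have "(\<lambda>p. cut_at (split_part \<tau> a \<alpha>) (Suc p)) ` {Suc a..<length \<tau>} = cut_at \<tau> ` {Suc a..<length \<tau>}"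
    using high by (intro image_cong) auto
  ultimately show ?thesis unfolding cuts_def lift_def by (simp add: image_Un image_image del: image_Suc_atLeastLessThan)
qed

text \<open>
  A 2-partition \<open>\<sigma>\<close> that crosses neither of the cuts at the two ends of the part with index \<open>a\<close>,
  and that separates two elements of this part, has all earlier parts in its first half (compare
  with \<open>i\<close>) and all later parts in its second half (compare with \<open>j\<close>). So it is determined by the
  splitting of this part.
\<close>
lemma compatible_is_lift:
  assumes \<sigma>: "\<sigma> \<in> two_partitions B" and ij: "precedes \<sigma> i j" "i \<in> \<tau> ! a" "j \<in> \<tau> ! a"
    and compat: "\<And>\<rho>. \<rho> \<in> cuts \<tau> \<Longrightarrow> \<not> crossing \<sigma> \<rho>"
  obtains \<alpha> where "\<alpha> \<in> two_partitions (\<tau> ! a)" "precedes \<alpha> i j" "\<sigma> = lift \<tau> a \<alpha>"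
proof -
  note \<sigma>D = two_partitionsD[OF \<sigma>] and prec = precedes_two_partition[OF \<sigma>]
  let ?\<alpha> = "[\<sigma> ! 0 \<inter> \<tau> ! a, \<sigma> ! 1 \<inter> \<tau> ! a]"
  have i: "i \<in> \<sigma> ! 0" and j: "j \<in> \<sigma> ! 1" using ij prec by auto
  have \<alpha>: "?\<alpha> \<in> two_partitions (\<tau> ! a)"
    unfolding two_partitions_pair using i j ij \<sigma>D ordered_partitionD[OF \<tau> a] by auto
  have "precedes ?\<alpha> i j" using precedes_two_partition[OF \<alpha>] i j ij by auto
  moreover have "\<sigma> = lift \<tau> a ?\<alpha>"
  proof (rule two_partitions_eqI[OF \<sigma> lift_in_two_partitions[OF \<alpha>]], rule Set.set_eqI)
    fix x
    show "x \<in> \<sigma> ! 0 \<longleftrightarrow> x \<in> lift \<tau> a ?\<alpha> ! 0"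
    proof (cases "x \<in> B")
      case False
      then show ?thesis using \<sigma>D(4) two_partitionsD(4)[OF lift_in_two_partitions[OF \<alpha>]] by auto
    next
      case True
      then obtain c where c: "c < length \<tau>" "x \<in> \<tau> ! c" using part_index_exists[OF \<tau>] by metis
      consider "c = a" | "c < a" | "a < c" by linarith
      then show ?thesis
      proof cases
        case 1
        then show ?thesis using lift_on_part[OF \<alpha>] c by auto
      next
        case 2
        have cut: "cut_at \<tau> a \<in> cuts \<tau>" "cut_at \<tau> a \<in> two_partitions B"
          using 2 a cut_in_two_partitions[OF \<tau>, of a] by (auto simp: cuts_def)
        have "\<not> precedes \<sigma> i x"
          using compat[OF cut(1)] in_cut[OF \<tau> c, of a] in_cut[OF \<tau> a ij(2), of a] 2 precedes_two_partition[OF cut(2)]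
          unfolding crossing_def by auto
        then have "x \<in> \<sigma> ! 0" using True i \<sigma>D by (auto simp: prec)
        then show ?thesis using lift_off_part[OF \<alpha> c(1) _ c(2)] 2 by auto
      next
        case 3
        have cut: "cut_at \<tau> (Suc a) \<in> cuts \<tau>" "cut_at \<tau> (Suc a) \<in> two_partitions B"
          using 3 c cut_in_two_partitions[OF \<tau>, of "Suc a"] by (auto simp: cuts_def)
        have "\<not> precedes \<sigma> x j"
          using compat[OF cut(1)] in_cut[OF \<tau> c, of "Suc a"] in_cut[OF \<tau> a ij(3), of "Suc a"] 3 precedes_two_partition[OF cut(2)]
          unfolding crossing_def by auto
        then have "x \<notin> \<sigma> ! 0" using j by (auto simp: prec)
        then show ?thesis using lift_off_part[OF \<alpha> c(1) _ c(2)] 3 by auto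
      qed
    qed
  qed
  ultimately show thesis using that \<alpha> by blast
qed

end

text \<open>
  Flags are built up one element at a time: a 2-partition that is compatible with the cuts of
  \<open>\<tau>\<close> and is not among them separates two elements of some part, hence arises by splitting it.
\<close>
lemma flag_eq_cuts:
  assumes B: "finite B" "B \<noteq> {}" and C: "flag B C"
  obtains \<tau> where "ordered_partition B \<tau>" "cuts \<tau> = C"
proof -
  have "finite C" using flag_finite[OF B(1) C] .
  then have "flag B C \<Longrightarrow> \<exists>\<tau>. ordered_partition B \<tau> \<and> cuts \<tau> = C"
  proof (induction C)
    case empty
    have "ordered_partition B [B]" "cuts [B] = {}"
      using B by (auto simp: ordered_partition_def cuts_def disjoint_family_on_def)
    then show ?case by blast
  next
    case (insert \<sigma> C)
    then obtain \<tau> where \<tau>: "ordered_partition B \<tau>" "cuts \<tau> = C"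
      using flag_subset[of B "insert \<sigma> C" C] by blast
    have \<sigma>: "\<sigma> \<in> two_partitions B" "\<sigma> \<notin> cuts \<tau>" and compat: "\<And>\<rho>. \<rho> \<in> cuts \<tau> \<Longrightarrow> \<not> crossing \<sigma> \<rho>"
      using insert \<tau> by (auto simp: flag_def)
    obtain a i j where a: "a < length \<tau>" and ij: "i \<in> \<tau> ! a" "j \<in> \<tau> ! a" "precedes \<sigma> i j"
      using cut_compatible_separates_part[OF \<tau>(1) \<sigma> compat] by blast
    obtain \<alpha> where "\<alpha> \<in> two_partitions (\<tau> ! a)" "\<sigma> = lift \<tau> a \<alpha>"
      using compatible_is_lift[OF \<tau>(1) a \<sigma>(1) ij(3,1,2) compat] by blast
    then show ?case
      using ordered_partition_split_part[OF \<tau>(1) a] cuts_split_part[OF \<tau>(1) a] \<tau>(2) by metis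
  qed
  then show thesis using that C by blast
qed

section \<open>Polynomials as combinations of monomials\<close>

interpretation kmod: module "pscale :: 'k::comm_ring_1 \<Rightarrow> ('b, 'k) pol \<Rightarrow> ('b, 'k) pol"
  by (rule module_pscale)

abbreviation monom :: "('b set list \<Rightarrow>\<^sub>0 nat) \<Rightarrow> ('b, 'k::comm_ring_1) pol" where
  "monom u \<equiv> Poly_Mapping.single u 1"

lemma lookup_pscale: "Poly_Mapping.lookup (pscale c p) u = c * Poly_Mapping.lookup p u"
  unfolding pscale_def mult_map_scale_conv_mult[symmetric]
  by (simp add: Poly_Mapping.map.rep_eq when_def)

lemma pscale_monom: "pscale c (monom u) = Poly_Mapping.single u c"
  by (simp add: pscale_def mult_single)

lemma pscale_mult_right: "p * pscale c q = pscale c (p * q)"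
  by (simp add: pscale_def mult.left_commute)

lemma sum_monoms:
  "p = (\<Sum>u\<in>Poly_Mapping.keys p. pscale (Poly_Mapping.lookup p u) (monom u))"
  by (rule poly_mapping_eqI)
     (simp add: lookup_sum pscale_monom lookup_single when_def in_keys_iff)

lemma kspan_monomI:
  assumes "\<And>u. u \<in> Poly_Mapping.keys p \<Longrightarrow> monom u \<in> kspan S"
  shows "p \<in> kspan S"
  by (subst sum_monoms) (intro kmod.span_sum kmod.span_scale assms)

lemma kspan_mult_left:
  assumes "y \<in> kspan T" and "\<And>t. t \<in> T \<Longrightarrow> x * t \<in> kspan U"
  shows "x * y \<in> kspan U"
  using assms(1)
proof (induction rule: kmod.span_induct_alt)
  case base
  then show ?case by (simp add: kmod.span_zero)
next
  case (step c t y)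
  then show ?case
    using assms(2) by (simp add: distrib_left pscale_mult_right kmod.span_add kmod.span_scale)
qed

lemma kspan_mult:
  assumes "x \<in> kspan S" "y \<in> kspan T"
    and "\<And>s t. s \<in> S \<Longrightarrow> t \<in> T \<Longrightarrow> s * t \<in> kspan U"
  shows "x * y \<in> kspan U"
proof (rule kspan_mult_left[OF assms(2)])
  fix t assume "t \<in> T"
  then have "t * x \<in> kspan U"
    using kspan_mult_left[OF assms(1), of t U] assms(3) by (simp add: mult.commute)
  then show "x * t \<in> kspan U" by (simp add: mult.commute)
qed

lemma kspan_image_sum:
  assumes "x \<in> kspan (f ` A)"
  obtains t c where "finite t" "t \<subseteq> A" "x = (\<Sum>u\<in>t. pscale (c u) (f u))"
proof -
  obtain T r where T: "finite T" "T \<subseteq> f ` A" "x = (\<Sum>y\<in>T. pscale (r y) y)"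
    using assms unfolding kmod.span_explicit by blast
  obtain t where t: "t \<subseteq> A" "inj_on f t" "T = f ` t" using T(2) unfolding subset_image_inj by blast
  have "finite t" using T(1) t(2,3) finite_imageD by blast
  moreover have "x = (\<Sum>u\<in>t. pscale (r (f u)) (f u))"
    unfolding T(3) t(3) by (simp add: sum.reindex[OF t(2)])
  ultimately show thesis using t(1) by (intro that[of t "\<lambda>u. r (f u)"])
qed

lemma kspan_subset: "S \<subseteq> kspan T \<Longrightarrow> kspan S \<subseteq> kspan T"
  by (rule kmod.span_minimal) (auto intro: kmod.subspace_span)

lemma keys_add_nat:
  "Poly_Mapping.keys (u + v) = Poly_Mapping.keys u \<union> Poly_Mapping.keys (v :: 'a \<Rightarrow>\<^sub>0 nat)"
  by (auto simp: in_keys_iff lookup_add)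

lemma kspan_monoms_of_R_carrier:
  assumes "p \<in> R_carrier B"
  shows "p \<in> kspan {monom u | u. Poly_Mapping.keys u \<subseteq> two_partitions B}"
  by (rule kspan_monomI, rule kmod.span_base) (use assms in \<open>auto simp: R_carrier_def\<close>)

text \<open>
  The \<open>'k\<close>-span of these monomials is the ideal generated by the quadratic relations.
\<close>
definition crossing_monoms :: "'b set \<Rightarrow> ('b, 'k::comm_ring_1) pol set" where
  "crossing_monoms B = {monom u | u. Poly_Mapping.keys u \<subseteq> two_partitions B \<and>
     \<not> flag B (Poly_Mapping.keys u)}"

lemma crossing_monoms_mult:
  assumes x: "x \<in> kspan (crossing_monoms B)" and y: "y \<in> R_carrier B"
  shows "y * x \<in> kspan (crossing_monoms B)"
proof (rule kspan_mult[OF kspan_monoms_of_R_carrier[OF y] x])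
  fix s t :: "('a, 'b) pol"
  assume "s \<in> {monom u | u. Poly_Mapping.keys u \<subseteq> two_partitions B}" "t \<in> crossing_monoms B"
  then obtain u v where u: "s = monom u" "Poly_Mapping.keys u \<subseteq> two_partitions B"
    and v: "t = monom v" "Poly_Mapping.keys v \<subseteq> two_partitions B" "\<not> flag B (Poly_Mapping.keys v)"
    unfolding crossing_monoms_def by blast
  have "\<not> flag B (Poly_Mapping.keys (u + v))"
    unfolding keys_add_nat using v(3) by (metis flag_subset sup_ge2)
  then have "monom (u + v) \<in> crossing_monoms B"
    using u(2) v(2) unfolding crossing_monoms_def by (intro CollectI exI[of _ "u + v"]) (simp add: keys_add_nat)
  then show "s * t \<in> kspan (crossing_monoms B)"
    unfolding u(1) v(1) mult_single mult_1_left by (rule kmod.span_base)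
qed

lemma lookup_crossing_monoms:
  assumes "x \<in> kspan (crossing_monoms B)" and "flag B (Poly_Mapping.keys u)"
  shows "Poly_Mapping.lookup x u = 0"
  using assms(1)
proof (induction rule: kmod.span_induct_alt)
  case (step c x y)
  then show ?case
    using assms(2) by (auto simp: crossing_monoms_def lookup_add lookup_pscale lookup_single when_def)
qed simp

lemma R_carrier_closed:
  shows R_carrier_zero: "0 \<in> R_carrier B"
    and R_carrier_one: "1 \<in> R_carrier B"
    and R_carrier_add: "x \<in> R_carrier B \<Longrightarrow> y \<in> R_carrier B \<Longrightarrow> x + y \<in> R_carrier B"
    and R_carrier_mult: "x \<in> R_carrier B \<Longrightarrow> y \<in> R_carrier B \<Longrightarrow> x * y \<in> R_carrier B"
proof -
  interpret cring "R_ring B :: ('a, 'k::comm_ring_1) pol ring" by (rule cring_R_ring)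
  show "0 \<in> R_carrier B" "1 \<in> R_carrier B"
    "x \<in> R_carrier B \<Longrightarrow> y \<in> R_carrier B \<Longrightarrow> x + y \<in> R_carrier B"
    "x \<in> R_carrier B \<Longrightarrow> y \<in> R_carrier B \<Longrightarrow> x * y \<in> R_carrier B"
    for x y :: "('a, 'k) pol"
    using zero_closed one_closed a_closed[of x y] m_closed[of x y] by (simp_all add: R_ring_def)
qed

lemma R_carrier_const: "Poly_Mapping.single 0 c \<in> R_carrier B"
  by (simp add: R_carrier_def)

lemma R_carrier_pscale: "x \<in> R_carrier B \<Longrightarrow> pscale c x \<in> R_carrier B"
  unfolding pscale_def by (rule R_carrier_mult[OF R_carrier_const])

lemma R_carrier_kspan: "S \<subseteq> R_carrier B \<Longrightarrow> kspan S \<subseteq> R_carrier B"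
  by (rule kmod.span_minimal)
     (auto simp: kmod.subspace_def intro: R_carrier_closed R_carrier_pscale)

lemma R_carrier_diff: "x \<in> R_carrier B \<Longrightarrow> y \<in> R_carrier B \<Longrightarrow> x - y \<in> R_carrier B"
  using kmod.span_diff[of x "R_carrier B" y] R_carrier_kspan[of "R_carrier B" B]
  by (auto intro: kmod.span_base)

lemma R_carrier_sum: "(\<And>i. i \<in> A \<Longrightarrow> f i \<in> R_carrier B) \<Longrightarrow> sum f A \<in> R_carrier B"
  by (induction A rule: infinite_finite_induct) (auto intro: R_carrier_closed)

lemma R_carrier_pvar: "\<sigma> \<in> two_partitions B \<Longrightarrow> pvar \<sigma> \<in> R_carrier B"
  by (auto simp: pvar_def R_carrier_def)

section \<open>Flag monomials and linear relations\<close>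

definition flag_exponent :: "'b set list set \<Rightarrow> 'b set list \<Rightarrow>\<^sub>0 nat" where
  "flag_exponent C = (\<Sum>\<sigma>\<in>C. Poly_Mapping.single \<sigma> 1)"

abbreviation flag_monomial :: "'b set list set \<Rightarrow> ('b, 'k::comm_ring_1) pol" where
  "flag_monomial C \<equiv> monom (flag_exponent C)"

lemma lookup_flag_exponent:
  "finite C \<Longrightarrow> Poly_Mapping.lookup (flag_exponent C) \<sigma> = (if \<sigma> \<in> C then 1 else 0)"
  by (simp add: flag_exponent_def lookup_sum lookup_single when_def)

lemma keys_flag_exponent: "finite C \<Longrightarrow> Poly_Mapping.keys (flag_exponent C) = C"
  by (auto simp: in_keys_iff lookup_flag_exponent split: if_splits)

lemma prod_pvar_eq_flag_monomial: "(\<Prod>\<sigma>\<in>C. pvar \<sigma>) = flag_monomial C"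
  by (induction C rule: infinite_finite_induct) (simp_all add: flag_exponent_def pvar_def mult_single)

lemma good_monomial_eq_flag_monomial:
  assumes "ordered_partition B \<tau>"
  shows "good_monomial \<tau> = flag_monomial (cuts \<tau>)"
  unfolding good_monomial_def prod_pvar_eq_flag_monomial[symmetric] cuts_def
  by (subst prod.reindex[OF cut_inj_on[OF assms]]) (simp add: cut_at_def)

text \<open>
  Modulo crossing monomials, the polynomials are the piecewise polynomial functions on the fan of
  the braid arrangement, and \<open>lower_sum B i\<close> is the \<open>i\<close>-th coordinate minus the smallest coordinate.
  Writing the linear relations as differences of these sums makes them additive:
  \<open>r1 B i j + r1 B j k = r1 B i k\<close>.
\<close>
definition lower_sum :: "'b set \<Rightarrow> 'b \<Rightarrow> ('b, 'k::comm_ring_1) pol" where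
  "lower_sum B i = (\<Sum>\<sigma> \<in> {\<sigma> \<in> two_partitions B. i \<in> \<sigma> ! 0}. pvar \<sigma>)"

lemma r1_eq_lower_sum:
  assumes B: "finite B" and ij: "i \<in> B" "j \<in> B"
  shows "r1 B i j = lower_sum B i - lower_sum B j"
proof -
  let ?T = "two_partitions B"
  have fin: "finite {\<sigma> \<in> ?T. P \<sigma>}" for P using finite_two_partitions[OF B] by simp
  have split: "lower_sum B k = (\<Sum>\<sigma> \<in> {\<sigma> \<in> ?T. precedes \<sigma> k l}. pvar \<sigma>)
      + (\<Sum>\<sigma> \<in> {\<sigma> \<in> ?T. k \<in> \<sigma> ! 0 \<and> l \<in> \<sigma> ! 0}. pvar \<sigma>)" if "l \<in> B" for k l
  proof -
    have "{\<sigma> \<in> ?T. k \<in> \<sigma> ! 0} = {\<sigma> \<in> ?T. precedes \<sigma> k l} \<union> {\<sigma> \<in> ?T. k \<in> \<sigma> ! 0 \<and> l \<in> \<sigma> ! 0}"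
      using precedes_two_partition two_partitionsD(3) that by fastforce
    moreover have "{\<sigma> \<in> ?T. precedes \<sigma> k l} \<inter> {\<sigma> \<in> ?T. k \<in> \<sigma> ! 0 \<and> l \<in> \<sigma> ! 0} = {}"
      using precedes_two_partition two_partitionsD(3) by fastforce
    ultimately show ?thesis unfolding lower_sum_def by (simp add: sum.union_disjoint fin)
  qed
  have "{\<sigma> \<in> ?T. i \<in> \<sigma> ! 0 \<and> j \<in> \<sigma> ! 0} = {\<sigma> \<in> ?T. j \<in> \<sigma> ! 0 \<and> i \<in> \<sigma> ! 0}" by blast
  then show ?thesis unfolding r1_def by (simp add: split[OF ij(2), of i] split[OF ij(1), of j])
qed

lemma r1_in_R_carrier: "r1 B i j \<in> R_carrier B"
  unfolding r1_def by (intro R_carrier_diff R_carrier_sum R_carrier_pvar) auto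

lemma flag_monomial_in_R_carrier:
  "finite C \<Longrightarrow> C \<subseteq> two_partitions B \<Longrightarrow> flag_monomial C \<in> R_carrier B"
  by (simp add: R_carrier_def keys_flag_exponent)

lemma pvar_mult_flag_monomial_crossing:
  assumes C: "finite C" "C \<subseteq> two_partitions B" and \<sigma>: "\<sigma> \<in> two_partitions B"
    and "\<rho> \<in> C" "crossing \<sigma> \<rho>"
  shows "pvar \<sigma> * flag_monomial C \<in> kspan (crossing_monoms B)"
proof (rule kmod.span_base)
  let ?u = "Poly_Mapping.single \<sigma> 1 + flag_exponent C"
  have keys: "Poly_Mapping.keys ?u = insert \<sigma> C"
    using C by (simp add: keys_add_nat keys_flag_exponent)
  have "\<not> flag B (insert \<sigma> C)" using assms(4,5) unfolding flag_def by blast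
  with keys have "monom ?u \<in> crossing_monoms B"
    unfolding crossing_monoms_def using C \<sigma> by (intro CollectI exI[of _ ?u]) simp
  then show "pvar \<sigma> * flag_monomial C \<in> crossing_monoms B"
    by (simp add: pvar_def mult_single)
qed

lemma pvar_lift_mult_flag_monomial:
  assumes B: "finite B" and \<tau>: "ordered_partition B \<tau>" and a: "a < length \<tau>"
    and \<alpha>: "\<alpha> \<in> two_partitions (\<tau> ! a)"
  shows "pvar (lift \<tau> a \<alpha>) * flag_monomial (cuts \<tau>) = good_monomial (split_part \<tau> a \<alpha>)"
  unfolding good_monomial_eq_flag_monomial[OF ordered_partition_split_part[OF \<tau> a \<alpha>]]
    cuts_split_part[OF \<tau> a \<alpha>] prod_pvar_eq_flag_monomial[symmetric]
  by (simp add: lift_notin_cuts[OF \<tau> a \<alpha>] flag_finite[OF B flag_cuts[OF \<tau>]])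

text \<open>
  Among the 2-partitions separating \<open>i\<close> from \<open>j\<close>, those that cross a cut of \<open>\<tau>\<close> contribute crossing
  monomials; the others are the lifts of the 2-partitions of the part containing \<open>i\<close> and \<open>j\<close>, and
  multiplying by their variables refines \<open>\<tau>\<close>. No 2-partition in the sum is itself a cut of \<open>\<tau>\<close>,
  so no squares appear.
\<close>
lemma r1_mult_flag_monomial:
  assumes B: "finite B" and \<tau>: "ordered_partition B \<tau>" and a: "a < length \<tau>"
    and ij: "i \<in> \<tau> ! a" "j \<in> \<tau> ! a"
  shows "r1 B i j * flag_monomial (cuts \<tau>) - r1_at \<tau> a i j
    \<in> kspan (crossing_monoms B :: ('b, 'k::comm_ring_1) pol set)"
proof -
  let ?J = "kspan (crossing_monoms B :: ('b, 'k) pol set)"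
  let ?m = "flag_monomial (cuts \<tau>) :: ('b, 'k) pol"
  have half: "(\<Sum>\<sigma> \<in> {\<sigma> \<in> two_partitions B. precedes \<sigma> k l}. pvar \<sigma>) * ?m
      - (\<Sum>\<alpha> \<in> {\<alpha> \<in> two_partitions (\<tau> ! a). precedes \<alpha> k l}. good_monomial (split_part \<tau> a \<alpha>)) \<in> ?J"
    if kl: "k \<in> \<tau> ! a" "l \<in> \<tau> ! a" for k l
  proof -
    let ?S = "{\<sigma> \<in> two_partitions B. precedes \<sigma> k l}"
    let ?A = "{\<alpha> \<in> two_partitions (\<tau> ! a). precedes \<alpha> k l}"
    have fin: "finite ?S" using finite_two_partitions[OF B] by simp
    have sub: "lift \<tau> a ` ?A \<subseteq> ?S"
      using lift_in_two_partitions[OF \<tau> a] precedes_lift[OF \<tau> a] by auto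
    have inj: "inj_on (lift \<tau> a) ?A" using inj_on_lift[OF \<tau> a] by (rule inj_on_subset) auto
    have "(\<Sum>\<sigma>\<in>?S. pvar \<sigma>) * ?m = (\<Sum>\<sigma>\<in>?S. pvar \<sigma> * ?m)" by (rule sum_distrib_right)
    also have "\<dots> = (\<Sum>\<sigma>\<in>?S - lift \<tau> a ` ?A. pvar \<sigma> * ?m) + (\<Sum>\<sigma>\<in>lift \<tau> a ` ?A. pvar \<sigma> * ?m)"
      using sum.subset_diff[OF sub fin] .
    also have "(\<Sum>\<sigma>\<in>lift \<tau> a ` ?A. pvar \<sigma> * ?m) = (\<Sum>\<alpha>\<in>?A. good_monomial (split_part \<tau> a \<alpha>))"
      by (simp add: sum.reindex[OF inj] pvar_lift_mult_flag_monomial[OF B \<tau> a])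
    finally have eq: "(\<Sum>\<sigma>\<in>?S. pvar \<sigma>) * ?m - (\<Sum>\<alpha>\<in>?A. good_monomial (split_part \<tau> a \<alpha>))
        = (\<Sum>\<sigma>\<in>?S - lift \<tau> a ` ?A. pvar \<sigma> * ?m)" by simp
    have "pvar \<sigma> * ?m \<in> ?J" if \<sigma>: "\<sigma> \<in> ?S - lift \<tau> a ` ?A" for \<sigma>
    proof -
      have \<sigma>': "\<sigma> \<in> two_partitions B" "precedes \<sigma> k l" using \<sigma> by simp_all
      obtain \<rho> where \<rho>: "\<rho> \<in> cuts \<tau>" "crossing \<sigma> \<rho>"
      proof (rule ccontr)
        assume "\<not> thesis"
        with that have "\<not> crossing \<sigma> \<rho>" if "\<rho> \<in> cuts \<tau>" for \<rho> using \<open>\<rho> \<in> cuts \<tau>\<close> by blast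
        from compatible_is_lift[OF \<tau> a \<sigma>' kl this]
        obtain \<alpha> where "\<alpha> \<in> two_partitions (\<tau> ! a)" "precedes \<alpha> k l" "\<sigma> = lift \<tau> a \<alpha>" .
        then show False using \<sigma> by simp
      qed
      have "cuts \<tau> \<subseteq> two_partitions B" using flag_cuts[OF \<tau>] by (simp add: flag_def)
      with pvar_mult_flag_monomial_crossing[OF flag_finite[OF B flag_cuts[OF \<tau>]] _ \<sigma>'(1) \<rho>]
      show ?thesis by simp
    qed
    then show ?thesis unfolding eq by (rule kmod.span_sum)
  qed
  have regroup: "(p - q) * m - (s - t) = (p * m - s) - (q * m - t)" for p q m s t :: "('b, 'k) pol"
    by (simp add: algebra_simps)
  show ?thesis
    unfolding r1_def r1_at_def regroup by (intro kmod.span_diff half ij)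
qed

section \<open>Products of linear relations\<close>

inductive_set r1_products :: "'b set \<Rightarrow> ('b, 'k::comm_ring_1) pol set" for B :: "'b set" where
  one: "1 \<in> r1_products B"
| mult: "\<lbrakk>i \<in> B; j \<in> B; p \<in> r1_products B\<rbrakk> \<Longrightarrow> r1 B i j * p \<in> r1_products B"

definition pos_r1_products :: "'b set \<Rightarrow> ('b, 'k::comm_ring_1) pol set" where
  "pos_r1_products B = {r1 B i j * p | i j p. i \<in> B \<and> j \<in> B \<and> p \<in> r1_products B}"

lemma r1_products_mult: "p \<in> r1_products B \<Longrightarrow> q \<in> r1_products B \<Longrightarrow> p * q \<in> r1_products B"
  by (induction p rule: r1_products.induct) (auto simp: mult.assoc intro: r1_products.mult)

lemma r1_products_power: "p \<in> r1_products B \<Longrightarrow> p ^ n \<in> r1_products B"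
  by (induction n) (auto intro: r1_products_mult r1_products.one)

lemma r1_products_prod: "(\<And>s. s \<in> S \<Longrightarrow> f s \<in> r1_products B) \<Longrightarrow> prod f S \<in> r1_products B"
  by (induction S rule: infinite_finite_induct) (auto intro: r1_products_mult r1_products.one)

lemma r1_products_in_R_carrier: "p \<in> r1_products B \<Longrightarrow> p \<in> R_carrier B"
  by (induction p rule: r1_products.induct) (auto intro: R_carrier_closed r1_in_R_carrier)

lemma pos_r1_products_mult:
  assumes "p \<in> pos_r1_products B" "q \<in> r1_products B"
  shows "p * q \<in> pos_r1_products B"
proof -
  obtain i j p' where p: "p = r1 B i j * p'" "i \<in> B" "j \<in> B" "p' \<in> r1_products B"
    using assms(1) unfolding pos_r1_products_def by blast
  have "p' * q \<in> r1_products B" using p(4) assms(2) by (rule r1_products_mult)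
  then show ?thesis
    unfolding pos_r1_products_def p(1) mult.assoc using p(2,3) by blast
qed

lemma pos_r1_products_r1: "i \<in> B \<Longrightarrow> j \<in> B \<Longrightarrow> r1 B i j \<in> pos_r1_products B"
  unfolding pos_r1_products_def using r1_products.one by (metis (mono_tags, lifting) mem_Collect_eq mult.right_neutral)

lemma pos_r1_products_subset: "p \<in> pos_r1_products B \<Longrightarrow> p \<in> r1_products B"
  unfolding pos_r1_products_def by (auto intro: r1_products.mult)

section \<open>Adapted polynomials\<close>

text \<open>
  A fixed choice of an ordered partition with the given set of cuts. It makes the step relations
  below depend on the flag alone.
\<close>
definition flag_partition :: "'b set \<Rightarrow> 'b set list set \<Rightarrow> 'b set list" where
  "flag_partition B C = (SOME \<tau>. ordered_partition B \<tau> \<and> cuts \<tau> = C)"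

definition rep :: "'b set \<Rightarrow> 'b" where
  "rep P = (SOME i. i \<in> P)"

text \<open>
  The linear relation for representatives of the two parts next to the cut \<open>\<sigma>\<close>. Since \<open>\<sigma>\<close> is the
  only element of \<open>C\<close> that separates them, this relation restricts to the variable of \<open>\<sigma>\<close> on
  \<open>C\<close>.
\<close>
definition step_relation :: "'b set \<Rightarrow> 'b set list set \<Rightarrow> 'b set list \<Rightarrow> ('b, 'k::comm_ring_1) pol" where
  "step_relation B C \<sigma> =
     (let \<tau> = flag_partition B C; p = the_inv_into {1..<length \<tau>} (cut_at \<tau>) \<sigma>
      in r1 B (rep (\<tau> ! (p - 1))) (rep (\<tau> ! p)))"

definition step_power :: "'b set \<Rightarrow> ('b set list \<Rightarrow>\<^sub>0 nat) \<Rightarrow> ('b, 'k::comm_ring_1) pol" where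
  "step_power B u = (\<Prod>\<sigma>\<in>Poly_Mapping.keys u.
     step_relation B (Poly_Mapping.keys u) \<sigma> ^ (Poly_Mapping.lookup u \<sigma> - 1))"

text \<open>
  The monomial \<open>u\<close> with one factor \<open>l\<^sub>\<sigma>\<close> kept for each \<open>\<sigma>\<close> in the support, and all further factors
  replaced by step relations.
\<close>
definition adapted :: "'b set \<Rightarrow> ('b set list \<Rightarrow>\<^sub>0 nat) \<Rightarrow> ('b, 'k::comm_ring_1) pol" where
  "adapted B u = step_power B u * flag_monomial (Poly_Mapping.keys u)"

text \<open>
  Equality after setting all variables outside \<open>C\<close> to zero. The formulation by the monomials of
  the difference makes compatibility with products immediate: monomials involving a variable
  outside \<open>C\<close> span an ideal.
\<close>
definition agree_on :: "'b set list set \<Rightarrow> ('b, 'k::comm_ring_1) pol \<Rightarrow> ('b, 'k) pol \<Rightarrow> bool" where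
  "agree_on C x y \<longleftrightarrow> (\<forall>v \<in> Poly_Mapping.keys (x - y). \<not> Poly_Mapping.keys v \<subseteq> C)"

lemma agree_on_refl: "agree_on C x x"
  by (simp add: agree_on_def)

lemma agree_on_lookup:
  "agree_on C x y \<longleftrightarrow>
    (\<forall>v. Poly_Mapping.keys v \<subseteq> C \<longrightarrow> Poly_Mapping.lookup x v = Poly_Mapping.lookup y v)"
  by (auto simp: agree_on_def in_keys_iff lookup_minus)

lemma agree_on_mult:
  assumes "agree_on C x x'" "agree_on C y y'"
  shows "agree_on C (x * y) (x' * y')"
  unfolding agree_on_def
proof
  fix v assume v: "v \<in> Poly_Mapping.keys (x * y - x' * y')"
  have "x * y - x' * y' = (x - x') * y + x' * (y - y')" by (simp add: algebra_simps)
  with v have "v \<in> Poly_Mapping.keys ((x - x') * y) \<union> Poly_Mapping.keys (x' * (y - y'))"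
    using keys_add by (metis subsetD)
  then obtain a b where "v = a + b"
    "a \<in> Poly_Mapping.keys (x - x') \<or> b \<in> Poly_Mapping.keys (y - y')"
    using keys_mult[of "x - x'" y] keys_mult[of x' "y - y'"] by blast
  then show "\<not> Poly_Mapping.keys v \<subseteq> C"
    using assms unfolding agree_on_def by (auto simp: keys_add_nat)
qed

lemma agree_on_power: "agree_on C x y \<Longrightarrow> agree_on C (x ^ n) (y ^ n)"
  by (induction n) (auto intro: agree_on_mult agree_on_refl)

lemma agree_on_prod: "(\<And>s. s \<in> S \<Longrightarrow> agree_on C (f s) (g s)) \<Longrightarrow> agree_on C (prod f S) (prod g S)"
  by (induction S rule: infinite_finite_induct) (auto intro: agree_on_mult agree_on_refl)

lemma monom_eq_prod:
  "monom u = (\<Prod>\<sigma>\<in>Poly_Mapping.keys u. pvar \<sigma> ^ Poly_Mapping.lookup u \<sigma>)"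
proof -
  have power: "pvar \<sigma> ^ n = monom (Poly_Mapping.single \<sigma> n)" for \<sigma> :: "'a set list" and n
    by (induction n) (simp_all add: pvar_def mult_single flip: single_add)
  have prod: "(\<Prod>s\<in>S. monom (e s)) = monom (sum e S)" for S :: "'a set list set" and e
    by (induction S rule: infinite_finite_induct) (simp_all add: mult_single)
  have "u = (\<Sum>\<sigma>\<in>Poly_Mapping.keys u. Poly_Mapping.single \<sigma> (Poly_Mapping.lookup u \<sigma>))"
    by (rule poly_mapping_eqI) (simp add: lookup_sum lookup_single when_def in_keys_iff)
  then show ?thesis unfolding power prod by simp
qed

lemma rep_in: "P \<noteq> {} \<Longrightarrow> rep P \<in> P"
  unfolding rep_def by (simp add: some_in_eq)

lemma lookup_pvar:
  "Poly_Mapping.lookup (pvar \<sigma>) v = (if v = Poly_Mapping.single \<sigma> 1 then 1 else 0)"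
  by (auto simp: pvar_def lookup_single when_def)

lemma single_one_eq_iff: "Poly_Mapping.single \<sigma> (1::nat) = Poly_Mapping.single \<rho> 1 \<longleftrightarrow> \<sigma> = \<rho>"
  by (metis lookup_single_eq lookup_single_not_eq zero_neq_one)

lemma lookup_lower_sum_single:
  assumes "finite B"
  shows "Poly_Mapping.lookup (lower_sum B i) (Poly_Mapping.single \<rho> 1) =
    (if \<rho> \<in> two_partitions B \<and> i \<in> \<rho> ! 0 then 1 else 0)"
  unfolding lower_sum_def lookup_sum lookup_pvar single_one_eq_iff
  by (simp add: finite_two_partitions[OF assms])

lemma lookup_lower_sum_other:
  assumes "\<nexists>\<rho>. v = Poly_Mapping.single \<rho> 1"
  shows "Poly_Mapping.lookup (lower_sum B i) v = 0"
  unfolding lower_sum_def lookup_sum lookup_pvar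
  by (rule sum.neutral) (use assms in auto)

text \<open>
  Multiplying by a step relation raises one exponent; this is how step relations act on adapted
  polynomials.
\<close>
lemma step_power_add_single:
  assumes \<sigma>: "\<sigma> \<in> Poly_Mapping.keys u"
  shows "Poly_Mapping.keys (u + Poly_Mapping.single \<sigma> 1) = Poly_Mapping.keys u"
    "step_power B (u + Poly_Mapping.single \<sigma> 1) = step_relation B (Poly_Mapping.keys u) \<sigma> * step_power B u"
proof -
  let ?C = "Poly_Mapping.keys u" and ?s = "step_relation B (Poly_Mapping.keys u)"
  let ?e = "\<lambda>u \<rho>. Poly_Mapping.lookup u \<rho> - 1"
  show keys: "Poly_Mapping.keys (u + Poly_Mapping.single \<sigma> 1) = ?C"
    using \<sigma> by (auto simp: keys_add_nat)
  have "?e (u + Poly_Mapping.single \<sigma> 1) \<sigma> = Suc (?e u \<sigma>)"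
    using \<sigma> by (simp add: lookup_add in_keys_iff)
  moreover have "?e (u + Poly_Mapping.single \<sigma> 1) \<rho> = ?e u \<rho>" if "\<rho> \<noteq> \<sigma>" for \<rho>
    using that by (simp add: lookup_add lookup_single when_def)
  ultimately show "step_power B (u + Poly_Mapping.single \<sigma> 1) = ?s \<sigma> * step_power B u"
    unfolding step_power_def keys
    by (simp add: prod.remove[OF finite_keys \<sigma>] mult.assoc)
qed

lemma step_power_flag_exponent: "finite C \<Longrightarrow> step_power B (flag_exponent C) = 1"
  unfolding step_power_def by (rule prod.neutral) (simp add: keys_flag_exponent lookup_flag_exponent)

lemma adapted_flag_exponent: "finite C \<Longrightarrow> adapted B (flag_exponent C) = flag_monomial C"
  by (simp add: adapted_def step_power_flag_exponent keys_flag_exponent)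

lemma keys_adapted:
  assumes v: "v \<in> Poly_Mapping.keys (adapted B u :: ('b, 'k::comm_ring_1) pol)"
  shows "Poly_Mapping.keys u \<subseteq> Poly_Mapping.keys v"
proof -
  let ?p = "step_power B u :: ('b, 'k) pol" and ?m = "flag_monomial (Poly_Mapping.keys u) :: ('b, 'k) pol"
  obtain a b where "v = a + b" "b \<in> Poly_Mapping.keys ?m"
    using keys_mult[of ?p ?m] v unfolding adapted_def by blast
  then show ?thesis by (auto simp: keys_add_nat keys_flag_exponent split: if_splits)
qed

context
  fixes B :: "'b set"
  assumes B: "finite B" "B \<noteq> {}"
begin

lemma flag_partition:
  assumes "flag B C"
  shows "ordered_partition B (flag_partition B C)" "cuts (flag_partition B C) = C"
proof -
  obtain \<tau> where "ordered_partition B \<tau> \<and> cuts \<tau> = C" using flag_eq_cuts[OF B assms] by blast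
  then have "ordered_partition B (flag_partition B C) \<and> cuts (flag_partition B C) = C"
    unfolding flag_partition_def by (rule someI)
  then show "ordered_partition B (flag_partition B C)" "cuts (flag_partition B C) = C" by auto
qed

lemma rep_part:
  assumes "flag B C" "a < length (flag_partition B C)"
  shows "rep (flag_partition B C ! a) \<in> flag_partition B C ! a" "rep (flag_partition B C ! a) \<in> B"
proof -
  note D = ordered_partitionD[OF flag_partition(1)[OF assms(1)] assms(2)]
  show "rep (flag_partition B C ! a) \<in> flag_partition B C ! a" using rep_in[OF D(1)] .
  then show "rep (flag_partition B C ! a) \<in> B" using D(2) by blast
qed

lemma step_relation_cut_at:
  assumes "flag B C" "1 \<le> p" "p < length (flag_partition B C)"
  shows "step_relation B C (cut_at (flag_partition B C) p) =
    r1 B (rep (flag_partition B C ! (p - 1))) (rep (flag_partition B C ! p))"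
  unfolding step_relation_def Let_def
  using the_inv_into_f_f[OF cut_inj_on[OF flag_partition(1)[OF assms(1)]], of p] assms(2,3) by simp

lemma step_relation_obtain:
  assumes C: "flag B C" and \<sigma>: "\<sigma> \<in> C"
  obtains p where "1 \<le> p" "p < length (flag_partition B C)" "\<sigma> = cut_at (flag_partition B C) p"
  using \<sigma> flag_partition(2)[OF C] unfolding cuts_def by force

lemma step_relation_in_pos_r1_products:
  assumes C: "flag B C" and \<sigma>: "\<sigma> \<in> C"
  shows "step_relation B C \<sigma> \<in> pos_r1_products B"
proof -
  obtain p where p: "1 \<le> p" "p < length (flag_partition B C)" "\<sigma> = cut_at (flag_partition B C) p"
    using step_relation_obtain[OF assms] .
  then show ?thesis
    unfolding p(3) step_relation_cut_at[OF C p(1,2)] by (intro pos_r1_products_r1 rep_part[OF C]) auto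
qed

text \<open>
  The coefficient of \<open>l\<^sub>\<rho>\<close> in the relation between \<open>i\<close> and \<open>j\<close> records on which sides of \<open>\<rho>\<close> they
  lie. With \<open>\<sigma>\<close> the cut after \<open>p\<close> parts and \<open>\<rho>\<close> the cut after \<open>q\<close> parts, \<open>i\<close> is in the first half of
  \<open>\<rho>\<close> if \<open>p - 1 < q\<close> and \<open>j\<close> is if \<open>p < q\<close>, so only \<open>q = p\<close> leaves a non-zero coefficient.
\<close>
lemma step_relation_agree:
  assumes C: "flag B C" and \<sigma>: "\<sigma> \<in> C"
  shows "agree_on C (step_relation B C \<sigma>) (pvar \<sigma>)"
  unfolding agree_on_lookup
proof (intro allI impI)
  let ?\<tau> = "flag_partition B C"
  note \<tau> = flag_partition[OF C]
  obtain p where p: "1 \<le> p" "p < length ?\<tau>" "\<sigma> = cut_at ?\<tau> p" using step_relation_obtain[OF assms] .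
  define i where "i = rep (?\<tau> ! (p - 1))"
  define j where "j = rep (?\<tau> ! p)"
  have p': "p - 1 < length ?\<tau>" using p by simp
  have i: "i \<in> ?\<tau> ! (p - 1)" "i \<in> B" and j: "j \<in> ?\<tau> ! p" "j \<in> B"
    unfolding i_def j_def using rep_part[OF C p'] rep_part[OF C p(2)] by auto
  have eq: "step_relation B C \<sigma> = lower_sum B i - lower_sum B j"
    unfolding p(3) step_relation_cut_at[OF C p(1,2)] i_def[symmetric] j_def[symmetric]
    by (rule r1_eq_lower_sum[OF B(1) i(2) j(2)])
  fix v :: "'b set list \<Rightarrow>\<^sub>0 nat" assume v: "Poly_Mapping.keys v \<subseteq> C"
  show "Poly_Mapping.lookup (step_relation B C \<sigma>) v = Poly_Mapping.lookup (pvar \<sigma>) v"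
  proof (cases "\<exists>\<rho>. v = Poly_Mapping.single \<rho> 1")
    case True
    then obtain \<rho> where \<rho>: "v = Poly_Mapping.single \<rho> 1" by blast
    then have "\<rho> \<in> C" using v by simp
    then have 2: "\<rho> \<in> two_partitions B" using C by (auto simp: flag_def)
    obtain q where q: "1 \<le> q" "q < length ?\<tau>" "\<rho> = cut_at ?\<tau> q"
      using step_relation_obtain[OF C \<open>\<rho> \<in> C\<close>] .
    have "\<sigma> = \<rho> \<longleftrightarrow> p = q" 
      using inj_on_eq_iff[OF cut_inj_on[OF \<tau>(1)], of p q] p q by auto
    moreover have "i \<in> \<rho> ! 0 \<longleftrightarrow> p - 1 < q" "j \<in> \<rho> ! 0 \<longleftrightarrow> p < q"
      unfolding q(3) using in_cut(1)[OF \<tau>(1) p' i(1)] in_cut(1)[OF \<tau>(1) p(2) j(1)] by auto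
    ultimately show ?thesis
      unfolding eq \<rho> lookup_minus lookup_lower_sum_single[OF B(1)] lookup_pvar single_one_eq_iff
      using p(1) 2 by auto
  next
    case False
    then show ?thesis
      unfolding eq lookup_minus lookup_lower_sum_other[OF False] lookup_pvar by simp
  qed
qed

lemma adapted_agree:
  assumes C: "flag B (Poly_Mapping.keys u)"
  shows "agree_on (Poly_Mapping.keys u) (adapted B u) (monom u)"
proof -
  let ?C = "Poly_Mapping.keys u"
  have "monom u = (\<Prod>\<sigma>\<in>?C. pvar \<sigma> ^ (Poly_Mapping.lookup u \<sigma> - 1) * pvar \<sigma>)"
    unfolding monom_eq_prod[of u] by (rule prod.cong) (auto simp: in_keys_iff power_eq_if)
  then have eq: "monom u = (\<Prod>\<sigma>\<in>?C. pvar \<sigma> ^ (Poly_Mapping.lookup u \<sigma> - 1)) * flag_monomial ?C"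
    by (simp add: prod.distrib flip: prod_pvar_eq_flag_monomial)
  show ?thesis
    unfolding eq adapted_def step_power_def
    by (intro agree_on_mult agree_on_prod agree_on_power agree_on_refl step_relation_agree C)
qed

lemma step_power_in_r1_products:
  assumes "flag B (Poly_Mapping.keys u)"
  shows "step_power B u \<in> r1_products B"
  unfolding step_power_def
  by (intro r1_products_prod r1_products_power pos_r1_products_subset step_relation_in_pos_r1_products assms)

lemma step_power_pos:
  assumes C: "flag B (Poly_Mapping.keys u)" and u: "u \<noteq> flag_exponent (Poly_Mapping.keys u)"
  shows "step_power B u \<in> (pos_r1_products B :: ('b, 'k::comm_ring_1) pol set)"
proof -
  let ?C = "Poly_Mapping.keys u"
  obtain \<sigma> where "Poly_Mapping.lookup u \<sigma> \<noteq> (if \<sigma> \<in> ?C then 1 else 0)"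
    using u poly_mapping_eqI[of u "flag_exponent ?C"] lookup_flag_exponent[of ?C] by auto
  then have \<sigma>: "\<sigma> \<in> ?C" "Poly_Mapping.lookup u \<sigma> \<ge> 2" by (auto simp: in_keys_iff split: if_splits)
  define v where "v = u - Poly_Mapping.single \<sigma> 1"
  have "u = v + Poly_Mapping.single \<sigma> 1"
    by (rule poly_mapping_eqI) (use \<sigma> in \<open>auto simp: v_def lookup_add lookup_minus lookup_single when_def\<close>)
  moreover have "\<sigma> \<in> Poly_Mapping.keys v"
    using \<sigma>(2) by (simp add: v_def in_keys_iff lookup_minus)
  ultimately have keys: "Poly_Mapping.keys v = ?C"
    and eq: "(step_power B u :: ('b, 'k) pol) = step_relation B ?C \<sigma> * step_power B v"
    using step_power_add_single[of \<sigma> v] by simp_all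
  show ?thesis
    unfolding eq using C keys
    by (intro pos_r1_products_mult step_relation_in_pos_r1_products step_power_in_r1_products \<sigma>(1)) simp_all
qed

lemma adapted_in_R_carrier:
  assumes "flag B (Poly_Mapping.keys u)"
  shows "adapted B u \<in> R_carrier B"
  unfolding adapted_def
  using step_power_in_r1_products[OF assms] assms
  by (intro R_carrier_mult r1_products_in_R_carrier flag_monomial_in_R_carrier) (auto simp: flag_def)

text \<open>
  By induction on the size of the support, the coefficient of \<open>u\<close> in the sum is \<open>c u\<close>: an adapted
  polynomial with another support contains \<open>u\<close> only if its support is strictly smaller, and then
  its coefficient is already known to vanish; one with the same support contains no monomial with
  this support but its own.
\<close>
lemma adapted_independent:
  fixes c :: "('b set list \<Rightarrow>\<^sub>0 nat) \<Rightarrow> 'k::comm_ring_1"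
  assumes t: "finite t" "\<And>u. u \<in> t \<Longrightarrow> flag B (Poly_Mapping.keys u)"
    and zero: "\<And>v. flag B (Poly_Mapping.keys v) \<Longrightarrow>
      Poly_Mapping.lookup (\<Sum>u\<in>t. pscale (c u) (adapted B u)) v = 0"
    and u: "u \<in> t"
  shows "c u = 0"
  using u
proof (induction "card (Poly_Mapping.keys u)" arbitrary: u rule: less_induct)
  case less
  note flag_u = t(2)[OF less.prems]
  have other: "c v * Poly_Mapping.lookup (adapted B v) u = 0" if v: "v \<in> t - {u}" for v
  proof (cases "Poly_Mapping.keys v = Poly_Mapping.keys u")
    case True
    have "flag B (Poly_Mapping.keys v)" using v t(2) by blast
    then have "agree_on (Poly_Mapping.keys v) (adapted B v :: ('b, 'k) pol) (monom v)"
      by (rule adapted_agree)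
    then have "Poly_Mapping.lookup (adapted B v :: ('b, 'k) pol) u = Poly_Mapping.lookup (monom v :: ('b, 'k) pol) u"
      unfolding agree_on_lookup using True by blast
    also have "\<dots> = 0" using v by (simp add: lookup_single when_def)
    finally show ?thesis by simp
  next
    case False
    show ?thesis
    proof (cases "Poly_Mapping.lookup (adapted B v :: ('b, 'k) pol) u = 0")
      case nonzero: False
      have "Poly_Mapping.keys v \<subseteq> Poly_Mapping.keys u"
        using nonzero by (intro keys_adapted) (simp add: in_keys_iff)
      with False have "card (Poly_Mapping.keys v) < card (Poly_Mapping.keys u)"
        by (intro psubset_card_mono) auto
      then have "c v = 0" using less.hyps v by blast
      then show ?thesis by simp
    qed simp
  qed
  have self: "Poly_Mapping.lookup (adapted B u :: ('b, 'k) pol) u = 1"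
  proof -
    have "agree_on (Poly_Mapping.keys u) (adapted B u :: ('b, 'k) pol) (monom u)"
      using flag_u by (rule adapted_agree)
    then show ?thesis unfolding agree_on_lookup by simp
  qed
  have "0 = (\<Sum>v\<in>t. c v * Poly_Mapping.lookup (adapted B v) u)"
    using zero[OF flag_u] by (simp add: lookup_sum lookup_pscale)
  also have "\<dots> = c u" using other self by (simp add: sum.remove[OF t(1) less.prems])
  finally show ?case by simp
qed

end

section \<open>Ideals of the polynomial ring\<close>

lemma crossing_monoms_in_R_carrier: "crossing_monoms B \<subseteq> R_carrier B"
  by (auto simp: crossing_monoms_def R_carrier_def)

lemma I_gens_in_R_carrier: "I_gens B \<subseteq> R_carrier B"
  unfolding I_gens_def by (auto intro: r1_in_R_carrier R_carrier_mult R_carrier_pvar)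

text \<open>
  Negatives come for free, as multiples by the constant \<open>-1\<close>.
\<close>
lemma idealI_R_ring:
  fixes B :: "'b set"
  assumes "Z \<subseteq> R_carrier B" "0 \<in> Z"
    and "\<And>x y. x \<in> Z \<Longrightarrow> y \<in> Z \<Longrightarrow> x + y \<in> Z"
    and "\<And>x y. x \<in> Z \<Longrightarrow> y \<in> R_carrier B \<Longrightarrow> y * x \<in> Z"
  shows "ideal Z (R_ring B :: ('b, 'k::comm_ring_1) pol ring)"
proof -
  interpret cring "R_ring B :: ('b, 'k) pol ring" by (rule cring_R_ring)
  have minus: "- x \<in> Z" if "x \<in> Z" for x
    using assms(4)[OF that, of "Poly_Mapping.single 0 (- 1)"] R_carrier_const[of "- 1" B]
    by (simp add: single_uminus)
  have a_inv: "\<ominus>\<^bsub>R_ring B\<^esub> x = - x" if x: "x \<in> Z" for x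
    using minus[OF x] x assms(1)
    by (intro minus_equality) (auto simp: R_ring_def)
  show ?thesis
  proof (rule idealI)
    show "ring (R_ring B :: ('b, 'k) pol ring)" by (rule ring_axioms)
    show "subgroup Z (add_monoid (R_ring B))"
    proof (rule subgroup.intro)
      show "Z \<subseteq> carrier (add_monoid (R_ring B))" using assms(1) by (simp add: R_ring_def)
      show "x \<otimes>\<^bsub>add_monoid (R_ring B)\<^esub> y \<in> Z" if "x \<in> Z" "y \<in> Z" for x y
        using assms(3)[OF that] by (simp add: R_ring_def)
      show "\<one>\<^bsub>add_monoid (R_ring B)\<^esub> \<in> Z" using assms(2) by (simp add: R_ring_def)
      show "inv\<^bsub>add_monoid (R_ring B)\<^esub> x \<in> Z" if "x \<in> Z" for x
        using a_inv[OF that] minus[OF that] by (simp add: a_inv_def)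
    qed
    show "x \<otimes>\<^bsub>R_ring B\<^esub> a \<in> Z" if "a \<in> Z" "x \<in> carrier (R_ring B)" for a x
      using assms(4) that by (simp add: R_ring_def)
    show "a \<otimes>\<^bsub>R_ring B\<^esub> x \<in> Z" if "a \<in> Z" "x \<in> carrier (R_ring B)" for a x
      using assms(4) that by (simp add: R_ring_def mult.commute)
  qed
qed

lemma I_ideal_ideal:
  fixes B :: "'b set"
  shows "ideal (I_ideal B) (R_ring B :: ('b, 'k::comm_ring_1) pol ring)"
proof -
  interpret cring "R_ring B :: ('b, 'k) pol ring" by (rule cring_R_ring)
  show ?thesis
    unfolding I_ideal_def using I_gens_in_R_carrier by (intro genideal_ideal) (simp add: R_ring_def)
qed

lemma I_ideal_closed:
  fixes B :: "'b set"
  shows I_gens_subset_I_ideal: "I_gens B \<subseteq> I_ideal B"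
    and I_ideal_mult: "x \<in> I_ideal B \<Longrightarrow> y \<in> R_carrier B \<Longrightarrow> y * x \<in> I_ideal B"
    and kspan_I_ideal: "kspan (I_ideal B) = I_ideal B"
proof -
  interpret cring "R_ring B :: ('b, 'k::comm_ring_1) pol ring" by (rule cring_R_ring)
  show "I_gens B \<subseteq> (I_ideal B :: ('b, 'k) pol set)"
    unfolding I_ideal_def using I_gens_in_R_carrier by (intro genideal_self) (simp add: R_ring_def)
  interpret I: ideal "I_ideal B" "R_ring B :: ('b, 'k) pol ring" by (rule I_ideal_ideal)
  show mult: "y * x \<in> I_ideal B" if "x \<in> I_ideal B" "y \<in> R_carrier B" for x y :: "('b, 'k) pol"
    using I.I_l_closed[of x y] that by (simp add: R_ring_def)
  have "kmod.subspace (I_ideal B :: ('b, 'k) pol set)"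
    unfolding kmod.subspace_def
    using I.zero_closed I.a_closed mult[OF _ R_carrier_const]
    by (auto simp: R_ring_def pscale_def)
  then show "kspan (I_ideal B) = (I_ideal B :: ('b, 'k) pol set)" by (simp add: kmod.span_eq_iff)
qed

text \<open>
  Two crossing 2-partitions are distinct, so their product divides the monomial.
\<close>
lemma crossing_monoms_in_I_ideal:
  fixes B :: "'b set"
  shows "kspan (crossing_monoms B) \<subseteq> (I_ideal B :: ('b, 'k::comm_ring_1) pol set)"
proof -
  have "crossing_monoms B \<subseteq> (I_ideal B :: ('b, 'k) pol set)"
  proof
    fix x :: "('b, 'k) pol" assume "x \<in> crossing_monoms B"
    then obtain u \<sigma> \<rho> where u: "x = monom u" "Poly_Mapping.keys u \<subseteq> two_partitions B"
      and cross: "\<sigma> \<in> Poly_Mapping.keys u" "\<rho> \<in> Poly_Mapping.keys u" "crossing \<sigma> \<rho>"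
      unfolding crossing_monoms_def flag_def by blast
    obtain i j where ij: "precedes \<sigma> i j" "precedes \<rho> j i" using cross(3) unfolding crossing_def by blast
    have two: "\<sigma> \<in> two_partitions B" "\<rho> \<in> two_partitions B" using u cross by auto
    have i: "i \<in> \<sigma> ! 0" "i \<in> \<rho> ! 1" and j: "j \<in> \<rho> ! 0"
      using ij precedes_two_partition[OF two(1)] precedes_two_partition[OF two(2)] by auto
    have "\<sigma> \<noteq> \<rho>" using i two_partitionsD(3)[OF two(2)] by auto
    have inB: "i \<in> B" "j \<in> B" using i(1) j two_partitionsD(4)[OF two(1)] two_partitionsD(4)[OF two(2)] by auto
    define v where "v = u - Poly_Mapping.single \<sigma> 1 - Poly_Mapping.single \<rho> 1"
    have "u = v + (Poly_Mapping.single \<sigma> 1 + Poly_Mapping.single \<rho> 1)"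
      by (rule poly_mapping_eqI)
         (use cross \<open>\<sigma> \<noteq> \<rho>\<close> in \<open>auto simp: v_def lookup_add lookup_minus lookup_single when_def in_keys_iff\<close>)
    then have x: "x = monom v * (pvar \<sigma> * pvar \<rho>)" unfolding u(1) by (simp add: pvar_def mult_single)
    have "Poly_Mapping.keys v \<subseteq> Poly_Mapping.keys u"
      unfolding v_def by (auto simp: in_keys_iff lookup_minus)
    then have "monom v \<in> (R_carrier B :: ('b, 'k) pol set)" using u(2) by (auto simp: R_carrier_def)
    moreover have "pvar \<sigma> * pvar \<rho> \<in> (I_gens B :: ('b, 'k) pol set)"
      unfolding I_gens_def using two inB ij by blast
    ultimately show "x \<in> I_ideal B"
      unfolding x by (intro I_ideal_mult subsetD[OF I_gens_subset_I_ideal])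
  qed
  from kmod.span_mono[OF this] show ?thesis unfolding kspan_I_ideal .
qed

lemma r1_at_in_I_ideal:
  fixes B :: "'b set"
  assumes B: "finite B" and \<tau>: "ordered_partition B \<tau>" and a: "a < length \<tau>" and ij: "i \<in> \<tau> ! a" "j \<in> \<tau> ! a"
  shows "r1_at \<tau> a i j \<in> (I_ideal B :: ('b, 'k::comm_ring_1) pol set)"
proof -
  have inB: "i \<in> B" "j \<in> B" using ij ordered_partitionD(2)[OF \<tau> a] by auto
  have C: "flag B (cuts \<tau>)" using flag_cuts[OF \<tau>] .
  have "r1 B i j \<in> (I_ideal B :: ('b, 'k) pol set)"
    by (rule subsetD[OF I_gens_subset_I_ideal]) (use inB in \<open>auto simp: I_gens_def\<close>)
  moreover have "flag_monomial (cuts \<tau>) \<in> (R_carrier B :: ('b, 'k) pol set)"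
    using flag_finite[OF B C] C by (intro flag_monomial_in_R_carrier) (auto simp: flag_def)
  ultimately have prod: "flag_monomial (cuts \<tau>) * r1 B i j \<in> (I_ideal B :: ('b, 'k) pol set)"
    by (rule I_ideal_mult)
  have "r1 B i j * flag_monomial (cuts \<tau>) - r1_at \<tau> a i j \<in> (I_ideal B :: ('b, 'k) pol set)"
    using crossing_monoms_in_I_ideal r1_mult_flag_monomial[OF B \<tau> a ij] by (rule subsetD)
  then have "r1 B i j * flag_monomial (cuts \<tau>) - (r1 B i j * flag_monomial (cuts \<tau>) - r1_at \<tau> a i j)
      \<in> kspan (I_ideal B :: ('b, 'k) pol set)"
    using prod by (intro kmod.span_diff kmod.span_base) (simp_all add: mult.commute)
  then show ?thesis unfolding kspan_I_ideal by simp
qed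

section \<open>Generation by flag monomials over the linear relations\<close>

abbreviation flags :: "'b set \<Rightarrow> 'b set list set set" where
  "flags B \<equiv> {C. flag B C}"

abbreviation larger_flags :: "'b set \<Rightarrow> 'b set list set \<Rightarrow> 'b set list set set" where
  "larger_flags B C \<equiv> {D. flag B D \<and> card C < card D}"

definition multiples :: "('b, 'k::comm_ring_1) pol set \<Rightarrow> 'b set list set set \<Rightarrow> ('b, 'k) pol set" where
  "multiples P F = {p * flag_monomial C | p C. p \<in> P \<and> C \<in> F}"

definition r1_at_set :: "'b set \<Rightarrow> 'b set list set set \<Rightarrow> ('b, 'k::comm_ring_1) pol set" where
  "r1_at_set B F = {r1_at \<tau> a i j | \<tau> a i j. ordered_partition B \<tau> \<and> cuts \<tau> \<in> F \<and> a < length \<tau>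
     \<and> i \<in> \<tau> ! a \<and> j \<in> \<tau> ! a}"

definition adapted_nonreduced :: "'b set \<Rightarrow> 'b set list set set \<Rightarrow> ('b, 'k::comm_ring_1) pol set" where
  "adapted_nonreduced B F = {adapted B u | u. Poly_Mapping.keys u \<in> F \<and> u \<noteq> flag_exponent (Poly_Mapping.keys u)}"

text \<open>
  This will turn out to contain the ideal. The products of linear relations have at least one
  factor.
\<close>
definition relation_span :: "'b set \<Rightarrow> ('b, 'k::comm_ring_1) pol set" where
  "relation_span B = kspan (multiples (pos_r1_products B) (flags B) \<union> crossing_monoms B)"

lemma in_span_superset: "x \<in> kspan S \<Longrightarrow> S \<subseteq> T \<Longrightarrow> x \<in> kspan T"
  using kmod.span_mono by blast

context
  fixes B :: "'b set"
  assumes B: "finite B" "B \<noteq> {}"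
begin

lemma flag_card_le: "flag B C \<Longrightarrow> card C \<le> card (two_partitions B)"
  unfolding flag_def by (intro card_mono finite_two_partitions B) blast

text \<open>
  Triangularity: \<open>u\<close> differs from its adapted polynomial, which is a product of linear relations
  times a flag monomial, by monomials with strictly larger support. The size of the support is
  bounded by the number of 2-partitions.
\<close>
lemma flag_monom_generated:
  assumes "flag B (Poly_Mapping.keys u)"
  shows "monom u \<in> kspan (multiples (r1_products B) (flags B) \<union> crossing_monoms B :: ('b, 'k::comm_ring_1) pol set)"
  using assms
proof (induction "card (two_partitions B) - card (Poly_Mapping.keys u)" arbitrary: u rule: less_induct)
  case less
  let ?C = "Poly_Mapping.keys u"
  let ?Z = "kspan (multiples (r1_products B) (flags B) \<union> crossing_monoms B :: ('b, 'k) pol set)"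
  have base: "(adapted B u :: ('b, 'k) pol) \<in> ?Z"
    unfolding adapted_def
    by (rule kmod.span_base)
       (use less.prems step_power_in_r1_products[OF B less.prems] in \<open>auto simp: multiples_def\<close>)
  have "(monom u - adapted B u :: ('b, 'k) pol) \<in> ?Z"
  proof (rule kspan_monomI)
    fix w assume w: "w \<in> Poly_Mapping.keys (monom u - adapted B u :: ('b, 'k) pol)"
    have agree: "agree_on ?C (adapted B u :: ('b, 'k) pol) (monom u)"
      using adapted_agree[OF B less.prems] .
    have "Poly_Mapping.lookup (adapted B u :: ('b, 'k) pol) w \<noteq> Poly_Mapping.lookup (monom u :: ('b, 'k) pol) w"
      using w by (simp add: in_keys_iff lookup_minus)
    with agree have new: "\<not> Poly_Mapping.keys w \<subseteq> ?C" unfolding agree_on_lookup by blast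
    then have "w \<noteq> u" by blast
    then have w': "w \<in> Poly_Mapping.keys (adapted B u :: ('b, 'k) pol)"
      using w by (simp add: in_keys_iff lookup_minus lookup_single when_def)
    have two: "Poly_Mapping.keys w \<subseteq> two_partitions B"
      using adapted_in_R_carrier[OF B less.prems, where ?'a = 'k] w' unfolding R_carrier_def by blast
    show "monom w \<in> ?Z"
    proof (cases "flag B (Poly_Mapping.keys w)")
      case True
      have "?C \<subset> Poly_Mapping.keys w" using keys_adapted[OF w'] new by blast
      then have "card ?C < card (Poly_Mapping.keys w)" by (intro psubset_card_mono) auto
      with flag_card_le[OF True] have
        "card (two_partitions B) - card (Poly_Mapping.keys w) < card (two_partitions B) - card ?C" by linarith
      then show ?thesis using less.hyps True by blast
    next
      case False
      then have "monom w \<in> crossing_monoms B"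
        unfolding crossing_monoms_def using two by (intro CollectI exI[of _ w]) simp
      then show ?thesis by (intro kmod.span_base UnI2)
    qed
  qed
  from kmod.span_add[OF this base] show ?case by simp
qed

lemma R_carrier_generated:
  assumes "x \<in> R_carrier B"
  shows "x \<in> kspan (multiples (r1_products B) (flags B) \<union> crossing_monoms B)"
proof (rule kspan_monomI)
  fix u assume "u \<in> Poly_Mapping.keys x"
  then have "Poly_Mapping.keys u \<subseteq> two_partitions B" using assms unfolding R_carrier_def by blast
  then have "flag B (Poly_Mapping.keys u) \<or> monom u \<in> crossing_monoms B"
    unfolding crossing_monoms_def by blast
  then show "monom u \<in> kspan (multiples (r1_products B) (flags B) \<union> crossing_monoms B)"
    using flag_monom_generated by (metis UnI2 kmod.span_base)
qed

section \<open>An ideal containing the defining relations\<close>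

lemma multiples_in_R_carrier:
  assumes "P \<subseteq> R_carrier B" "F \<subseteq> (flags B)"
  shows "multiples P F \<subseteq> R_carrier B"
proof
  fix x assume "x \<in> multiples P F"
  then obtain p C where "x = p * flag_monomial C" "p \<in> P" "flag B C"
    using assms(2) unfolding multiples_def by blast
  then show "x \<in> R_carrier B"
    using assms(1) flag_finite[OF B(1)]
    by (auto intro!: R_carrier_mult flag_monomial_in_R_carrier simp: flag_def)
qed

lemma relation_span_in_R_carrier: "relation_span B \<subseteq> R_carrier B"
  unfolding relation_span_def
  by (intro R_carrier_kspan Un_least multiples_in_R_carrier crossing_monoms_in_R_carrier)
     (auto dest: pos_r1_products_subset r1_products_in_R_carrier)

text \<open>
  Multiply the flag monomial by \<open>y\<close> first and rewrite the result by the generation lemma; at least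
  the factors of the original product of linear relations survive.
\<close>
lemma pos_multiples_mult:
  fixes t y :: "('b, 'k::comm_ring_1) pol"
  assumes t: "t \<in> multiples (pos_r1_products B) (flags B)" and y: "y \<in> R_carrier B"
  shows "y * t \<in> relation_span B"
proof -
  obtain p C where p: "t = p * flag_monomial C" "p \<in> pos_r1_products B" "flag B C"
    using t unfolding multiples_def by blast
  have "flag_monomial C * y \<in> R_carrier B"
    using p(3) flag_finite[OF B(1) p(3)] y
    by (intro R_carrier_mult flag_monomial_in_R_carrier) (auto simp: flag_def)
  from R_carrier_generated[OF this]
  have "p * (flag_monomial C * y) \<in> relation_span B"
    unfolding relation_span_def
  proof (rule kspan_mult_left)
    fix s :: "('b, 'k) pol" assume "s \<in> multiples (r1_products B) (flags B) \<union> crossing_monoms B"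
    then consider (mult) q D where "s = q * flag_monomial D" "q \<in> r1_products B" "flag B D"
      | (cross) "s \<in> crossing_monoms B"
      unfolding multiples_def by blast
    then show "p * s \<in> kspan (multiples (pos_r1_products B) (flags B) \<union> crossing_monoms B)"
    proof cases
      case mult
      have "p * q \<in> pos_r1_products B" using p(2) mult(2) by (rule pos_r1_products_mult)
      moreover have "p * s = p * q * flag_monomial D" using mult by (simp add: mult.assoc)
      ultimately have "p * s \<in> multiples (pos_r1_products B) (flags B)"
        unfolding multiples_def using mult(3) by blast
      then show ?thesis by (intro kmod.span_base UnI1)
    next
      case cross
      have "p \<in> R_carrier B"
        using p(2) by (intro r1_products_in_R_carrier pos_r1_products_subset)
      then have "p * s \<in> kspan (crossing_monoms B)"
        using crossing_monoms_mult[OF kmod.span_base[OF cross]] by blast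
      then show ?thesis by (rule in_span_superset) simp
    qed
  qed
  then show ?thesis unfolding p(1) by (simp add: mult_ac)
qed

lemma relation_span_mult:
  fixes x y :: "('b, 'k::comm_ring_1) pol"
  assumes x: "x \<in> relation_span B" and y: "y \<in> R_carrier B"
  shows "y * x \<in> relation_span B"
  unfolding relation_span_def
proof (rule kspan_mult_left[OF x[unfolded relation_span_def]])
  fix t :: "('b, 'k) pol" assume "t \<in> multiples (pos_r1_products B) (flags B) \<union> crossing_monoms B"
  then show "y * t \<in> kspan (multiples (pos_r1_products B) (flags B) \<union> crossing_monoms B)"
  proof
    assume "t \<in> multiples (pos_r1_products B) (flags B)"
    from pos_multiples_mult[OF this y] show ?thesis unfolding relation_span_def .
  next
    assume "t \<in> crossing_monoms B"
    from crossing_monoms_mult[OF kmod.span_base[OF this] y]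
    show ?thesis by (rule in_span_superset) simp
  qed
qed

lemma I_ideal_subset_relation_span: "I_ideal B \<subseteq> (relation_span B :: ('b, 'k::comm_ring_1) pol set)"
proof -
  interpret cring "R_ring B :: ('b, 'k) pol ring" by (rule cring_R_ring)
  have "I_gens B \<subseteq> (relation_span B :: ('b, 'k) pol set)"
  proof
    fix x :: "('b, 'k) pol" assume "x \<in> I_gens B"
    then consider (lin) i j where "x = r1 B i j" "i \<in> B" "j \<in> B"
      | (quad) \<sigma> \<rho> where "x = pvar \<sigma> * pvar \<rho>" "\<sigma> \<in> two_partitions B" "\<rho> \<in> two_partitions B" "crossing \<sigma> \<rho>"
      unfolding I_gens_def crossing_def by blast
    then show "x \<in> relation_span B"
    proof cases
      case lin
      have "r1 B i j \<in> (pos_r1_products B :: ('b, 'k) pol set)" using lin(2,3) by (rule pos_r1_products_r1)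
      moreover have "flag B {}" by (simp add: flag_def)
      moreover have "x = r1 B i j * flag_monomial {}" using lin(1) by (simp add: flag_exponent_def)
      ultimately have "x \<in> multiples (pos_r1_products B) (flags B)" unfolding multiples_def by blast
      then show ?thesis unfolding relation_span_def by (intro kmod.span_base UnI1)
    next
      case quad
      have "x = pvar \<sigma> * flag_monomial {\<rho>}" using quad(1) by (simp add: flag_exponent_def pvar_def)
      then have "x \<in> kspan (crossing_monoms B)"
        using pvar_mult_flag_monomial_crossing[of "{\<rho>}" B \<sigma> \<rho>] quad by auto
      then show ?thesis unfolding relation_span_def by (rule in_span_superset) simp
    qed
  qed
  moreover have "ideal (relation_span B) (R_ring B :: ('b, 'k) pol ring)"
    by (rule idealI_R_ring[OF relation_span_in_R_carrier])
       (auto simp: relation_span_def kmod.span_zero kmod.span_add relation_span_mult[unfolded relation_span_def])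
  ultimately show ?thesis unfolding I_ideal_def by (intro genideal_minimal)
qed

end

section \<open>Reduction of multiples of flag monomials\<close>

text \<open>
  The possible outcomes of reducing a multiple of the flag monomial of \<open>C\<close>. The elements
  \<open>r1_at \<tau> a i j\<close> appear without factors in front; with a linear relation as a factor they fall into
  the multiples of larger flag monomials.
\<close>
definition level_span :: "'b set \<Rightarrow> 'b set list set \<Rightarrow> ('b, 'k::comm_ring_1) pol set" where
  "level_span B C = kspan (adapted_nonreduced B {C} \<union> r1_at_set B {C}
     \<union> multiples (pos_r1_products B) (larger_flags B C) \<union> crossing_monoms B)"

context
  fixes B :: "'b set"
  assumes B: "finite B" "B \<noteq> {}"
begin

text \<open>
  To go from \<open>i\<close> to \<open>j\<close>, pass from \<open>i\<close> to the representative of its part, then along the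
  representatives of consecutive parts, and finally from a representative to \<open>j\<close>.
\<close>
lemma r1_in_step_span:
  assumes C: "flag B C" and ij: "i \<in> B" "j \<in> B"
  defines "\<tau> \<equiv> flag_partition B C"
  shows "r1 B i j \<in> kspan (step_relation B C ` C \<union>
    {r1 B k l | k l. \<exists>a < length \<tau>. k \<in> \<tau> ! a \<and> l \<in> \<tau> ! a} :: ('b, 'k::comm_ring_1) pol set)"
    (is "_ \<in> kspan ?G")
proof -
  have \<tau>: "ordered_partition B \<tau>" "cuts \<tau> = C" unfolding \<tau>_def using flag_partition[OF B C] by auto
  let ?y = "lower_sum B :: 'b \<Rightarrow> ('b, 'k) pol"
  have part: "?y k - ?y l \<in> kspan ?G" if "a < length \<tau>" "k \<in> \<tau> ! a" "l \<in> \<tau> ! a" for a k l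
  proof -
    have "k \<in> B" "l \<in> B" using ordered_partitionD(2)[OF \<tau>(1) that(1)] that by auto
    then have "?y k - ?y l = r1 B k l" using r1_eq_lower_sum[OF B(1)] by metis
    also have "\<dots> \<in> ?G" using that by blast
    finally show ?thesis by (rule kmod.span_base)
  qed
  have reps: "?y (rep (\<tau> ! 0)) - ?y (rep (\<tau> ! a)) \<in> kspan ?G" if "a < length \<tau>" for a
    using that
  proof (induction a)
    case 0
    then show ?case by (simp add: kmod.span_zero)
  next
    case (Suc a)
    let ?\<sigma> = "cut_at \<tau> (Suc a)"
    have "?\<sigma> \<in> C" using Suc.prems \<tau>(2) by (auto simp: cuts_def)
    then have "(step_relation B C ?\<sigma> :: ('b, 'k) pol) \<in> ?G" by (intro UnI1 imageI)
    then have "(step_relation B C ?\<sigma> :: ('b, 'k) pol) \<in> kspan ?G" by (rule kmod.span_base)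
    moreover have "step_relation B C ?\<sigma> = (r1 B (rep (\<tau> ! a)) (rep (\<tau> ! Suc a)) :: ('b, 'k) pol)"
      using step_relation_cut_at[OF B C, of "Suc a", folded \<tau>_def] Suc.prems by simp
    moreover have "r1 B (rep (\<tau> ! a)) (rep (\<tau> ! Suc a)) = ?y (rep (\<tau> ! a)) - ?y (rep (\<tau> ! Suc a))"
      using rep_part(2)[OF B C, of a] rep_part(2)[OF B C, of "Suc a"] Suc.prems
      unfolding \<tau>_def by (intro r1_eq_lower_sum[OF B(1)]) auto
    ultimately have step: "?y (rep (\<tau> ! a)) - ?y (rep (\<tau> ! Suc a)) \<in> kspan ?G"
      by (simp only:)
    have "?y (rep (\<tau> ! 0)) - ?y (rep (\<tau> ! a)) \<in> kspan ?G" using Suc by simp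
    from kmod.span_add[OF this step] show ?case by simp
  qed
  have from_first: "?y (rep (\<tau> ! 0)) - ?y k \<in> kspan ?G" if k: "k \<in> B" for k
  proof -
    obtain a where a: "a < length \<tau>" "k \<in> \<tau> ! a" using part_index_exists[OF \<tau>(1) k] .
    have "rep (\<tau> ! a) \<in> \<tau> ! a" using rep_part(1)[OF B C] a(1) unfolding \<tau>_def by blast
    from kmod.span_add[OF reps[OF a(1)] part[OF a(1) this a(2)]] show ?thesis by simp
  qed
  from kmod.span_diff[OF from_first[OF ij(2)] from_first[OF ij(1)]]
  show ?thesis unfolding r1_eq_lower_sum[OF B(1) ij] by simp
qed

lemma pos_mult_r1_at:
  assumes q: "q \<in> pos_r1_products B" and \<tau>: "ordered_partition B \<tau>" and a: "a < length \<tau>"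
  shows "q * r1_at \<tau> a i j \<in> kspan (multiples (pos_r1_products B) (larger_flags B (cuts \<tau>)))"
    (is "_ \<in> kspan ?M")
proof -
  have good: "q * good_monomial (split_part \<tau> a \<alpha>) \<in> kspan ?M" if \<alpha>: "\<alpha> \<in> two_partitions (\<tau> ! a)" for \<alpha>
  proof -
    let ?s = "split_part \<tau> a \<alpha>"
    have s: "ordered_partition B ?s" using ordered_partition_split_part[OF \<tau> a \<alpha>] .
    have "card (cuts \<tau>) < card (cuts ?s)"
      unfolding cuts_split_part[OF \<tau> a \<alpha>]
      using lift_notin_cuts[OF \<tau> a \<alpha>] flag_finite[OF B(1) flag_cuts[OF \<tau>]] by simp
    then have "q * flag_monomial (cuts ?s) \<in> ?M"
      unfolding multiples_def using q flag_cuts[OF s] by blast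
    then show ?thesis unfolding good_monomial_eq_flag_monomial[OF s] by (rule kmod.span_base)
  qed
  show ?thesis
    unfolding r1_at_def right_diff_distrib sum_distrib_left
    by (intro kmod.span_diff kmod.span_sum good) auto
qed

text \<open>
  A step relation raises an exponent. A relation inside a part turns the flag monomial into
  \<open>r1_at\<close>, and the remaining step relations either are absent, or push the result to larger flags.
\<close>
lemma r1_mult_adapted:
  assumes C: "flag B (Poly_Mapping.keys u)" and ij: "i \<in> B" "j \<in> B"
  shows "r1 B i j * adapted B u \<in> (level_span B (Poly_Mapping.keys u) :: ('b, 'k::comm_ring_1) pol set)"
proof -
  let ?C = "Poly_Mapping.keys u" 
  let ?\<tau> = "flag_partition B ?C"
  note \<tau> = flag_partition[OF B C]
  let ?a = "adapted B u :: ('b, 'k) pol"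
  have "?a * r1 B i j \<in> level_span B ?C"
    unfolding level_span_def
  proof (rule kspan_mult_left[OF r1_in_step_span[OF C ij]])
    fix t :: "('b, 'k) pol"
    assume "t \<in> step_relation B ?C ` ?C \<union> {r1 B k l |k l. \<exists>a<length ?\<tau>. k \<in> ?\<tau> ! a \<and> l \<in> ?\<tau> ! a}"
    then consider (step) \<sigma> where "t = step_relation B ?C \<sigma>" "\<sigma> \<in> ?C"
      | (part) k l a where "t = r1 B k l" "a < length ?\<tau>" "k \<in> ?\<tau> ! a" "l \<in> ?\<tau> ! a" by blast
    then have "?a * t \<in> level_span B ?C"
    proof cases
      case step
      let ?v = "u + Poly_Mapping.single \<sigma> 1"
      have keys: "Poly_Mapping.keys ?v = ?C" using step_power_add_single(1)[OF step(2)] .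
      have eq: "?a * t = adapted B ?v"
        unfolding adapted_def keys step_power_add_single(2)[OF step(2)] step(1) by (simp add: mult_ac)
      have "Poly_Mapping.lookup ?v \<sigma> \<noteq> Poly_Mapping.lookup (flag_exponent ?C) \<sigma>"
        using step(2) by (simp add: lookup_add lookup_flag_exponent in_keys_iff)
      then have "?v \<noteq> flag_exponent (Poly_Mapping.keys ?v)" unfolding keys by auto
      then have "?a * t \<in> adapted_nonreduced B {?C}"
        unfolding eq adapted_nonreduced_def using keys by blast
      then show ?thesis unfolding level_span_def by (intro kmod.span_base UnI1)
    next
      case part
      let ?P = "step_power B u :: ('b, 'k) pol"
      have P: "?P \<in> r1_products B" using step_power_in_r1_products[OF B C] .
      define J where "J = r1 B k l * flag_monomial ?C - (r1_at ?\<tau> a k l :: ('b, 'k) pol)"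
      have "J \<in> kspan (crossing_monoms B)"
        unfolding J_def using r1_mult_flag_monomial[OF B(1) \<tau>(1) part(2-4)] unfolding \<tau>(2) .
      then have "?P * J \<in> kspan (crossing_monoms B)"
        using r1_products_in_R_carrier[OF P] by (rule crossing_monoms_mult)
      then have J: "?P * J \<in> level_span B ?C"
        unfolding level_span_def by (rule in_span_superset) simp
      have N: "?P * r1_at ?\<tau> a k l \<in> level_span B ?C"
      proof (cases "u = flag_exponent ?C")
        case True
        have "?P = 1" by (subst True) (rule step_power_flag_exponent[OF finite_keys])
        moreover have "r1_at ?\<tau> a k l \<in> (r1_at_set B {?C} :: ('b, 'k) pol set)"
          unfolding r1_at_set_def using \<tau> part by blast
        ultimately have "?P * r1_at ?\<tau> a k l \<in> r1_at_set B {?C}" by simp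
        then show ?thesis unfolding level_span_def by (intro kmod.span_base UnI1 UnI2)
      next
        case False
        have "?P \<in> pos_r1_products B" using step_power_pos[OF B C False] .
        from pos_mult_r1_at[OF this \<tau>(1) part(2), of k l]
        show ?thesis unfolding level_span_def \<tau>(2) by (rule in_span_superset) auto
      qed
      have "?a * t = ?P * J + ?P * r1_at ?\<tau> a k l"
        unfolding J_def adapted_def part(1) by (simp add: algebra_simps)
      then show ?thesis using J N unfolding level_span_def by (simp add: kmod.span_add)
    qed
    then show "?a * t \<in> kspan (adapted_nonreduced B {?C} \<union> r1_at_set B {?C}
        \<union> multiples (pos_r1_products B) (larger_flags B ?C) \<union> crossing_monoms B)"
      unfolding level_span_def .
  qed
  then show ?thesis by (simp add: mult.commute)
qed

lemma r1_mult_level_span: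
  assumes C: "flag B C" and ij: "i \<in> B" "j \<in> B" and x: "x \<in> (level_span B C :: ('b, 'k::comm_ring_1) pol set)"
  shows "r1 B i j * x \<in> level_span B C"
  unfolding level_span_def
proof (rule kspan_mult_left[OF x[unfolded level_span_def]])
  let ?r = "r1 B i j :: ('b, 'k) pol"
  fix t :: "('b, 'k) pol"
  assume "t \<in> adapted_nonreduced B {C} \<union> r1_at_set B {C}
      \<union> multiples (pos_r1_products B) (larger_flags B C) \<union> crossing_monoms B"
  then consider (adapted) "t \<in> adapted_nonreduced B {C}" | (rel) "t \<in> r1_at_set B {C}"
    | (larger) "t \<in> multiples (pos_r1_products B) (larger_flags B C)" | (cross) "t \<in> crossing_monoms B"
    by blast
  then have "?r * t \<in> level_span B C"
  proof cases
    case adapted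
    then obtain u where "t = adapted B u" "Poly_Mapping.keys u = C"
      unfolding adapted_nonreduced_def by blast
    then show ?thesis using r1_mult_adapted[of u, OF _ ij] C by metis
  next
    case rel
    then obtain \<tau> a k l where \<tau>: "t = r1_at \<tau> a k l" "ordered_partition B \<tau>" "cuts \<tau> = C" "a < length \<tau>"
      unfolding r1_at_set_def by blast
    have "?r \<in> pos_r1_products B" using ij by (rule pos_r1_products_r1)
    from pos_mult_r1_at[OF this \<tau>(2,4), of k l]
    show ?thesis unfolding level_span_def \<tau>(1,3) by (rule in_span_superset) auto
  next
    case larger
    then obtain p D where D: "t = p * flag_monomial D" "p \<in> pos_r1_products B" "D \<in> larger_flags B C"
      unfolding multiples_def by blast
    have "?r * p \<in> pos_r1_products B"
      using pos_r1_products_r1[OF ij] pos_r1_products_subset[OF D(2)] by (rule pos_r1_products_mult)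
    moreover have "?r * t = ?r * p * flag_monomial D" unfolding D(1) by (simp add: mult.assoc)
    ultimately have "?r * t \<in> multiples (pos_r1_products B) (larger_flags B C)"
      unfolding multiples_def using D(3) by blast
    then show ?thesis unfolding level_span_def by (intro kmod.span_base UnI1 UnI2)
  next
    case cross
    have "?r * t \<in> kspan (crossing_monoms B)"
      using crossing_monoms_mult[OF kmod.span_base[OF cross] r1_in_R_carrier] .
    then show ?thesis unfolding level_span_def by (rule in_span_superset) simp
  qed
  then show "?r * t \<in> kspan (adapted_nonreduced B {C} \<union> r1_at_set B {C}
      \<union> multiples (pos_r1_products B) (larger_flags B C) \<union> crossing_monoms B)"
    unfolding level_span_def .
qed

lemma pos_multiple_in_level_span:
  assumes C: "flag B C" and p: "p \<in> pos_r1_products B"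
  shows "p * flag_monomial C \<in> level_span B C"
proof -
  have fin: "finite C" using flag_finite[OF B(1) C] .
  have *: "r1 B i j * q * flag_monomial C \<in> level_span B C" if "q \<in> r1_products B" "i \<in> B" "j \<in> B" for q i j
    using that
  proof (induction q arbitrary: i j rule: r1_products.induct)
    case one
    then show ?case
      using r1_mult_adapted[of "flag_exponent C" i j] C
      by (simp add: keys_flag_exponent[OF fin] adapted_flag_exponent[OF fin])
  next
    case (mult k l q)
    from r1_mult_level_span[OF C mult.prems mult.IH[OF mult.hyps(1,2)]]
    show ?case by (simp add: mult.assoc)
  qed
  obtain i j q where "p = r1 B i j * q" "i \<in> B" "j \<in> B" "q \<in> r1_products B"
    using p unfolding pos_r1_products_def by blast
  then show ?thesis using * by blast
qed

text \<open>
  Multiples of larger flag monomials are reduced by induction; flags cannot have more elements than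
  there are 2-partitions.
\<close>
lemma pos_multiple_reduction:
  fixes p :: "('b, 'k::comm_ring_1) pol"
  assumes "flag B C" and "p \<in> pos_r1_products B"
  shows "p * flag_monomial C \<in>
    kspan (r1_at_set B (flags B) \<union> (adapted_nonreduced B (flags B) \<union> crossing_monoms B))"
    (is "_ \<in> kspan ?X")
  using assms
proof (induction "card (two_partitions B) - card C" arbitrary: C p rule: less_induct)
  case less
  have "adapted_nonreduced B {C} \<union> r1_at_set B {C}
      \<union> multiples (pos_r1_products B) (larger_flags B C) \<union> crossing_monoms B \<subseteq> kspan ?X"
  proof (intro Un_least)
    show "r1_at_set B {C} \<subseteq> kspan ?X"
      by (rule subset_trans[OF _ kmod.span_superset])
        (use less.prems(1) in \<open>unfold r1_at_set_def, blast\<close>)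
    show "adapted_nonreduced B {C} \<subseteq> kspan ?X"
      by (rule subset_trans[OF _ kmod.span_superset])
        (use less.prems(1) in \<open>unfold adapted_nonreduced_def, blast\<close>)
    show "crossing_monoms B \<subseteq> kspan ?X"
      by (rule subset_trans[OF _ kmod.span_superset]) blast
    show "multiples (pos_r1_products B) (larger_flags B C) \<subseteq> kspan ?X"
    proof
      fix t :: "('b, 'k) pol" assume "t \<in> multiples (pos_r1_products B) (larger_flags B C)"
      then obtain q D where D: "t = q * flag_monomial D" "q \<in> pos_r1_products B" "flag B D" "card C < card D"
        unfolding multiples_def by blast
      have "card (two_partitions B) - card D < card (two_partitions B) - card C"
        using D(4) flag_card_le[OF B D(3)] by linarith
      then show "t \<in> kspan ?X" unfolding D(1) using D(3,2) by (rule less.hyps)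
    qed
  qed
  then have "level_span B C \<subseteq> kspan ?X" unfolding level_span_def by (rule kspan_subset)
  then show ?case using pos_multiple_in_level_span[OF less.prems] by (rule subsetD)
qed

lemma I_ideal_reduction:
  "I_ideal B \<subseteq> kspan (r1_at_set B (flags B) \<union> (adapted_nonreduced B (flags B) \<union> crossing_monoms B))"
    (is "_ \<subseteq> kspan ?X")
proof -
  have "multiples (pos_r1_products B) (flags B) \<union> crossing_monoms B \<subseteq> kspan ?X"
  proof (rule Un_least)
    show "multiples (pos_r1_products B) (flags B) \<subseteq> kspan ?X"
      unfolding multiples_def using pos_multiple_reduction by blast
    show "crossing_monoms B \<subseteq> kspan ?X"
      by (rule subset_trans[OF _ kmod.span_superset]) blast
  qed
  then have "relation_span B \<subseteq> kspan ?X" unfolding relation_span_def by (rule kspan_subset)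
  then show ?thesis using I_ideal_subset_relation_span[OF B] by (rule subset_trans[rotated])
qed

text \<open>
  Flag monomials are the adapted polynomials of the square-free monomials, so \<open>g - w\<close> is a
  combination of pairwise different adapted polynomials.
\<close>
lemma flag_monomials_independent_of_nonreduced:
  fixes g w :: "('b, 'k::comm_ring_1) pol"
  assumes g: "g \<in> kspan {flag_monomial C | C. flag B C}"
    and w: "w \<in> kspan (adapted_nonreduced B (flags B))"
    and gw: "g - w \<in> kspan (crossing_monoms B)"
  shows "g = 0"
proof -
  let ?e = flag_exponent
  let ?good = "{u. flag B (Poly_Mapping.keys u) \<and> u = ?e (Poly_Mapping.keys u)}"
  let ?bad = "{u. flag B (Poly_Mapping.keys u) \<and> u \<noteq> ?e (Poly_Mapping.keys u)}"
  have "{flag_monomial C | C. flag B C} \<subseteq> (adapted B ` ?good :: ('b, 'k) pol set)"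
  proof
    fix x :: "('b, 'k) pol" assume "x \<in> {flag_monomial C | C. flag B C}"
    then obtain C where C: "x = flag_monomial C" "flag B C" by blast
    have fin: "finite C" using flag_finite[OF B(1) C(2)] .
    have "x = adapted B (?e C)" unfolding C(1) adapted_flag_exponent[OF fin] by (rule refl)
    moreover have "?e C \<in> ?good" using C(2) keys_flag_exponent[OF fin] by simp
    ultimately show "x \<in> adapted B ` ?good" by blast
  qed
  from in_span_superset[OF g this]
  obtain t c where t: "finite t" "t \<subseteq> ?good" "g = (\<Sum>u\<in>t. pscale (c u) (adapted B u))"
    by (rule kspan_image_sum)
  have "adapted_nonreduced B (flags B) \<subseteq> (adapted B ` ?bad :: ('b, 'k) pol set)"
    unfolding adapted_nonreduced_def by blast
  from in_span_superset[OF w this]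
  obtain s d where s: "finite s" "s \<subseteq> ?bad" "w = (\<Sum>u\<in>s. pscale (d u) (adapted B u))"
    by (rule kspan_image_sum)
  define e where "e = (\<lambda>u. if u \<in> t then c u else - d u)"
  have "t \<inter> s = {}" using t(2) s(2) by blast
  then have "(\<Sum>u\<in>t \<union> s. pscale (e u) (adapted B u))
      = (\<Sum>u\<in>t. pscale (e u) (adapted B u)) + (\<Sum>u\<in>s. pscale (e u) (adapted B u))"
    by (rule sum.union_disjoint[OF t(1) s(1)])
  also have "(\<Sum>u\<in>t. pscale (e u) (adapted B u)) = g"
    unfolding t(3) by (rule sum.cong) (simp_all add: e_def)
  also have "(\<Sum>u\<in>s. pscale (e u) (adapted B u)) = - w"
  proof -
    have "e u = - d u" if "u \<in> s" for u using that \<open>t \<inter> s = {}\<close> by (auto simp: e_def)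
    then show ?thesis unfolding s(3) by (simp add: kmod.scale_minus_left sum_negf)
  qed
  finally have sum: "(\<Sum>u\<in>t \<union> s. pscale (e u) (adapted B u)) = g - w" by simp
  have "e u = 0" if u: "u \<in> t \<union> s" for u
  proof (rule adapted_independent[OF B _ _ _ u])
    show "finite (t \<union> s)" using t(1) s(1) by simp
    show "flag B (Poly_Mapping.keys v)" if "v \<in> t \<union> s" for v using that t(2) s(2) by blast
    show "Poly_Mapping.lookup (\<Sum>u\<in>t \<union> s. pscale (e u) (adapted B u)) v = 0"
      if "flag B (Poly_Mapping.keys v)" for v
      unfolding sum using gw that by (rule lookup_crossing_monoms)
  qed
  then have "c u = 0" if "u \<in> t" for u using that unfolding e_def by (metis UnI1)
  then show ?thesis unfolding t(3) by (simp add: pscale_def)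
qed

end

section \<open>The relations among good monomials\<close>

theorem theorem2p9:
  fixes B :: "'b set"
  assumes "finite B" and "B \<noteq> {}"
  shows "kspan {r1_at \<tau> a i j | \<tau> a i j.
             ordered_partition B \<tau> \<and> a < length \<tau> \<and> card (\<tau> ! a) \<ge> 2
             \<and> i \<in> \<tau> ! a \<and> j \<in> \<tau> ! a \<and> i \<noteq> j}
       = (I_ideal B \<inter> kspan {good_monomial \<tau> | \<tau>. ordered_partition B \<tau>}
           :: ('b, 'k::comm_ring_1) pol set)"
    (is "kspan ?N = _ \<inter> kspan ?G")
proof
  note B = assms
  have good: "good_monomial \<tau> \<in> kspan ?G" if "ordered_partition B \<tau>" for \<tau>
    using that by (intro kmod.span_base) blast
  have N_good: "r1_at \<tau> a i j \<in> kspan ?G" if "ordered_partition B \<tau>" "a < length \<tau>" for \<tau> a i j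
    unfolding r1_at_def
    by (intro kmod.span_diff kmod.span_sum good ordered_partition_split_part[OF that]) auto
  have N: "x \<in> I_ideal B \<and> x \<in> kspan ?G" if xN: "x \<in> ?N" for x
  proof -
    obtain \<tau> a i j where x: "x = r1_at \<tau> a i j" "ordered_partition B \<tau>" "a < length \<tau>"
      "i \<in> \<tau> ! a" "j \<in> \<tau> ! a" using xN by blast
    show ?thesis unfolding x(1) using r1_at_in_I_ideal[OF B(1) x(2-5)] N_good[OF x(2,3)] ..
  qed
  have "?N \<subseteq> I_ideal B" by (rule subsetI) (erule conjunct1[OF N])
  from kmod.span_mono[OF this] have "kspan ?N \<subseteq> I_ideal B" by (simp only: kspan_I_ideal)
  moreover have "?N \<subseteq> kspan ?G" by (rule subsetI) (erule conjunct2[OF N])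
  then have N_G: "kspan ?N \<subseteq> kspan ?G" by (rule kspan_subset)
  ultimately show "kspan ?N \<subseteq> I_ideal B \<inter> kspan ?G" by (rule Int_greatest)
  have N_eq: "r1_at_set B (flags B) \<subseteq> kspan ?N"
  proof
    fix x :: "('b, 'k) pol" assume "x \<in> r1_at_set B (flags B)"
    then obtain \<tau> a i j where x: "x = r1_at \<tau> a i j" "ordered_partition B \<tau>" "a < length \<tau>"
      "i \<in> \<tau> ! a" "j \<in> \<tau> ! a" unfolding r1_at_set_def by blast
    show "x \<in> kspan ?N"
    proof (cases "i = j")
      case True
      then show ?thesis unfolding x(1) by (simp add: r1_at_def kmod.span_zero)
    next
      case False
      have "finite (\<tau> ! a)" using ordered_partitionD(2)[OF x(2,3)] B(1) by (rule finite_subset)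
      then have "card {i, j} \<le> card (\<tau> ! a)" using x(4,5) by (intro card_mono) auto
      then have "card (\<tau> ! a) \<ge> 2" using False by simp
      then show ?thesis using x False by (intro kmod.span_base) blast
    qed
  qed
  show "I_ideal B \<inter> kspan ?G \<subseteq> kspan ?N"
  proof
    fix f assume f: "f \<in> I_ideal B \<inter> kspan ?G"
    then have "f \<in> kspan (r1_at_set B (flags B) \<union> (adapted_nonreduced B (flags B) \<union> crossing_monoms B))"
      using I_ideal_reduction[OF B] by (rule subsetD[rotated, OF IntD1])
    then obtain n w c where f_eq: "f = n + (w + c)" and n: "n \<in> kspan (r1_at_set B (flags B))"
      and w: "w \<in> kspan (adapted_nonreduced B (flags B))" and c: "c \<in> kspan (crossing_monoms B)"
      unfolding kmod.span_Un by blast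
    have nN: "n \<in> kspan ?N" using kspan_subset[OF N_eq] n by (rule subsetD)
    have "f \<in> kspan ?G" using f by (rule IntD2)
    from kmod.span_diff[OF this subsetD[OF N_G nN]] have "f - n \<in> kspan ?G" .
    moreover have "?G \<subseteq> {flag_monomial C | C. flag B C}"
    proof
      fix x :: "('b, 'k) pol" assume "x \<in> ?G"
      then obtain \<tau> where \<tau>: "x = good_monomial \<tau>" "ordered_partition B \<tau>" by blast
      have "x = flag_monomial (cuts \<tau>)"
        unfolding \<tau>(1) by (rule good_monomial_eq_flag_monomial[OF \<tau>(2)])
      then show "x \<in> {flag_monomial C | C. flag B C}" using flag_cuts[OF \<tau>(2)] by blast
    qed
    ultimately have "f - n \<in> kspan {flag_monomial C | C. flag B C}" by (rule in_span_superset)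
    moreover have "f - n - w = c" unfolding f_eq by simp
    with c have "f - n - w \<in> kspan (crossing_monoms B)" by (simp only:)
    ultimately have "f - n = 0" by (rule flag_monomials_independent_of_nonreduced[OF B _ w])
    then have "f = n" by (rule right_minus_eq[THEN iffD1])
    then show "f \<in> kspan ?N" using nN by (simp only:)
  qed
qed

end
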